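(* CWCM with top-truncated votes for the rule $\text{plurality}_{av}$ (plurality with top-truncated ballots evaluated by the average-score scheme) is solvable in polynomial time, for any number of candidates (the number of candidates is not bounded and is part of the input).
   Context: An election has a finite set $C$ of $m$ candidates and voters with non-negative integer weights; a vote of weight $w$ counts as $w$ identical votes. A top-truncated vote is a linear order over a non-empty subset of $C$; the unranked candidates are regarded as tied with each other and below all ranked ones. A complete vote ranks all of $C$ and is a special case. A positional scoring rule is given by a scoring vector $\langle\alpha_1,\dots,\alpha_m\rangle$ with $\alpha_1\ge\dots\ge\alpha_m$; in a complete vote a candidate in position $i$ receives $\alpha_i$ points, and the winners are the candidates with highest total (weighted) score. Plurality has vector $\langle 1,0,\dots,0\rangle$. Average-score scheme $X_{av}$: in a vote ranking only $k<m$ candidates, the candidate in position $i\le k$ receives $\alpha_i$ and every unranked candidate receives $\frac{1}{m-k}\sum_{k<j\le m}\alpha_j$. CWCM (Constructive Weighted Coalitional Manipulation) with top-truncated votes: given a set $S$ of weighted votes of the non-manipulators (possibly top-truncated), the weights of a set $T$ of manipulators' votes, and a preferred candidate $p$, decide whether the votes in $T$ can be cast (each as an arbitrary top-truncated or complete vote) so that $p$ is a winner (not necessarily unique) of the election with votes $S\cup T$. Weights are encoded in binary. *)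

theory Defs
  imports Complex_Main
begin

section \<open>Positional scoring rules on top-truncated ballots\<close>

text \<open>
  A top-truncated vote over \<open>C\<close> is the list of its ranked candidates, best first; the candidates
  not occurring in the list are tied below all those occurring in it. A complete vote is the
  case \<open>set b = C\<close>.
\<close>

definition is_ballot :: "'c set \<Rightarrow> 'c list \<Rightarrow> bool" where
  "is_ballot C b \<longleftrightarrow> b \<noteq> [] \<and> distinct b \<and> set b \<subseteq> C"

text \<open>
  Scoring vectors are lists, so position \<open>i\<close> (counted from 1) has value \<open>\<alpha> ! (i - 1)\<close>, and
  \<open>m = length \<alpha>\<close>. A rule supplies one scoring vector for every number \<open>m\<close> of candidates.
\<close>

type_synonym scoring_rule = "nat \<Rightarrow> rat list"

definition is_scoring_rule :: "scoring_rule \<Rightarrow> bool" where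
  "is_scoring_rule r \<longleftrightarrow> (\<forall>m. length (r m) = m \<and> sorted_wrt (\<ge>) (r m))"

definition plurality :: scoring_rule where
  "plurality m = (if m = 0 then [] else 1 # replicate (m - 1) 0)"

lemma is_scoring_rule_plurality: "is_scoring_rule plurality"
  by (auto simp: is_scoring_rule_def plurality_def sorted_wrt_iff_nth_less nth_Cons')

text \<open>\<open>position b c\<close> counts from 0 and is meaningful only for \<open>c \<in> set b\<close>.\<close>

definition position :: "'c list \<Rightarrow> 'c \<Rightarrow> nat" where
  "position b c = length (takeWhile (\<lambda>d. d \<noteq> c) b)"

definition average_score :: "rat list \<Rightarrow> 'c list \<Rightarrow> 'c \<Rightarrow> rat" where
  "average_score \<alpha> b c =
     (if c \<in> set b then \<alpha> ! position b c
      else (\<Sum>j = length b..<length \<alpha>. \<alpha> ! j) / of_nat (length \<alpha> - length b))"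

definition total_score :: "rat list \<Rightarrow> (nat \<times> 'c list) list \<Rightarrow> 'c \<Rightarrow> rat" where
  "total_score \<alpha> votes c = (\<Sum>(w, b)\<leftarrow>votes. of_nat w * average_score \<alpha> b c)"

definition winners_av :: "scoring_rule \<Rightarrow> 'c set \<Rightarrow> (nat \<times> 'c list) list \<Rightarrow> 'c set" where
  "winners_av r C votes =
     {c \<in> C. \<forall>d \<in> C. total_score (r (card C)) votes d \<le> total_score (r (card C)) votes c}"


section \<open>Constructive weighted coalitional manipulation\<close>

text \<open>Candidates are named by natural numbers so that instances can be written down as strings.\<close>

record cwcm_instance =
  candidates :: "nat list"
  fixed_votes :: "(nat \<times> nat list) list"
  manip_weights :: "nat list"
  preferred :: nat

definition cwcm_instances :: "cwcm_instance set" where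
  "cwcm_instances =
     {I. distinct (candidates I)
       \<and> (\<forall>(w, b) \<in> set (fixed_votes I). is_ballot (set (candidates I)) b)
       \<and> preferred I \<in> set (candidates I)}"

definition cwcm_av :: "scoring_rule \<Rightarrow> cwcm_instance \<Rightarrow> bool" where
  "cwcm_av r I \<longleftrightarrow>
     (\<exists>bs. length bs = length (manip_weights I)
        \<and> (\<forall>b \<in> set bs. is_ballot (set (candidates I)) b)
        \<and> preferred I \<in> winners_av r (set (candidates I))
                           (fixed_votes I @ zip (manip_weights I) bs))"


section \<open>Encoding of instances\<close>

text \<open>
  Strings are over the symbols 1 to 5 (0 is reserved for the blank of the machine model):
  1 and 2 are the binary digits 0 and 1, 3 ends a number, 4 and 5 open and close a list.
  Numbers are written in binary without superfluous zeros, least significant digit first.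
\<close>

fun binary_digits :: "nat \<Rightarrow> nat list" where
  "binary_digits n = (if n = 0 then [] else (n mod 2 + 1) # binary_digits (n div 2))"

declare binary_digits.simps [simp del]

definition encode_nat :: "nat \<Rightarrow> nat list" where
  "encode_nat n = binary_digits n @ [3]"

definition encode_list :: "('a \<Rightarrow> nat list) \<Rightarrow> 'a list \<Rightarrow> nat list" where
  "encode_list f xs = 4 # concat (map f xs) @ [5]"

definition encode_vote :: "nat \<times> nat list \<Rightarrow> nat list" where
  "encode_vote = (\<lambda>(w, b). encode_nat w @ encode_list encode_nat b)"

definition encode_cwcm :: "cwcm_instance \<Rightarrow> nat list" where
  "encode_cwcm I =
     encode_list encode_nat (candidates I) @
     encode_list encode_vote (fixed_votes I) @
     encode_list encode_nat (manip_weights I) @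
     encode_nat (preferred I)"

lemma binary_digits_0: "binary_digits 0 = []"
  by (subst binary_digits.simps) simp

lemma binary_digits_pos:
  "n > 0 \<Longrightarrow> binary_digits n = (n mod 2 + 1) # binary_digits (n div 2)"
  by (subst binary_digits.simps) simp

lemma binary_digits_prefix_free:
  "binary_digits m @ 3 # xs = binary_digits n @ 3 # ys \<Longrightarrow> m = n \<and> xs = ys"
proof (induction m arbitrary: n rule: less_induct)
  case (less m)
  have ne: "k mod 2 + 1 \<noteq> 3" for k :: nat
    by presburger
  consider "m = 0" "n = 0" | "m = 0" "n > 0" | "m > 0" "n = 0" | "m > 0" "n > 0"
    by blast
  then show ?case
  proof cases
    case 1
    from less.prems show ?thesis
      unfolding 1 binary_digits_0 append_Nil list.inject by blast
  next
    case 2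
    from less.prems ne[of n] show ?thesis
      unfolding 2(1) binary_digits_0 binary_digits_pos[OF 2(2)] append_Nil append_Cons list.inject
      by metis
  next
    case 3
    from less.prems ne[of m] show ?thesis
      unfolding 3(2) binary_digits_0 binary_digits_pos[OF 3(1)] append_Nil append_Cons list.inject
      by metis
  next
    case 4
    from less.prems have "m mod 2 + 1 = n mod 2 + 1"
      and *: "binary_digits (m div 2) @ 3 # xs = binary_digits (n div 2) @ 3 # ys"
      unfolding binary_digits_pos[OF 4(1)] binary_digits_pos[OF 4(2)] append_Cons list.inject
      by blast+
    have lt: "m div 2 < m"
      using 4(1) by simp
    have div: "m div 2 = n div 2 \<and> xs = ys"
      by (rule less.IH[OF lt *])
    from \<open>m mod 2 + 1 = n mod 2 + 1\<close> conjunct1[OF div] have "m = n"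
      using div_mult_mod_eq[of m 2] div_mult_mod_eq[of n 2] by linarith
    with div show ?thesis
      by blast
  qed
qed

lemma encode_nat_prefix_free:
  "encode_nat m @ xs = encode_nat n @ ys \<Longrightarrow> m = n \<and> xs = ys"
  by (rule binary_digits_prefix_free) (simp add: encode_nat_def)

lemma encode_nat_Cons: "\<exists>s ss. encode_nat n = s # ss \<and> s \<noteq> 5"
proof (cases "n = 0")
  case False
  then have "encode_nat n = (n mod 2 + 1) # (binary_digits (n div 2) @ [3])"
    unfolding encode_nat_def by (subst binary_digits_pos) simp_all
  moreover have "n mod 2 + 1 \<noteq> 5"
    by presburger
  ultimately show ?thesis
    by blast
qed (simp add: encode_nat_def binary_digits_0)

lemma encode_list_prefix_free:
  assumes f: "\<And>x y us vs. f x @ us = f y @ vs \<Longrightarrow> x = y \<and> us = vs"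
    and nonclosing: "\<And>x. \<exists>s ss. f x = s # ss \<and> s \<noteq> 5"
  shows "encode_list f xs @ us = encode_list f ys @ vs \<Longrightarrow> xs = ys \<and> us = vs"
proof (induction xs arbitrary: ys)
  case Nil
  then show ?case
    using nonclosing[of "hd ys"] by (cases ys) (auto simp: encode_list_def)
next
  case (Cons x xs)
  show ?case
  proof (cases ys)
    case Nil
    then show ?thesis
      using nonclosing[of x] Cons.prems by (auto simp: encode_list_def)
  next
    case (Cons y ys')
    with Cons.prems have "f x @ (concat (map f xs) @ 5 # us) = f y @ (concat (map f ys') @ 5 # vs)"
      by (simp add: encode_list_def)
    from f[OF this] Cons.IH[of ys'] Cons show ?thesis
      by (simp add: encode_list_def)
  qed
qed

lemma encode_nat_list_prefix_free:
  "encode_list encode_nat xs @ us = encode_list encode_nat ys @ vs \<Longrightarrow> xs = ys \<and> us = vs"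
  by (rule encode_list_prefix_free[OF encode_nat_prefix_free encode_nat_Cons])

lemma encode_vote_prefix_free:
  "encode_vote x @ us = encode_vote y @ vs \<Longrightarrow> x = y \<and> us = vs"
  using encode_nat_prefix_free[of "fst x" _ "fst y"]
    encode_nat_list_prefix_free[of "snd x" us "snd y" vs]
  by (simp add: encode_vote_def case_prod_unfold prod_eq_iff)

lemma encode_vote_Cons: "\<exists>s ss. encode_vote v = s # ss \<and> s \<noteq> 5"
  using encode_nat_Cons[of "fst v"] by (cases v) (auto simp: encode_vote_def)

lemma encode_vote_list_prefix_free:
  "encode_list encode_vote xs @ us = encode_list encode_vote ys @ vs \<Longrightarrow> xs = ys \<and> us = vs"
  by (rule encode_list_prefix_free[OF encode_vote_prefix_free encode_vote_Cons])

lemma inj_encode_cwcm: "inj encode_cwcm"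
proof (rule injI)
  fix I J assume eq: "encode_cwcm I = encode_cwcm J"
  note 1 = encode_nat_list_prefix_free[OF eq[unfolded encode_cwcm_def]]
  note 2 = encode_vote_list_prefix_free[OF conjunct2[OF 1]]
  note 3 = encode_nat_list_prefix_free[OF conjunct2[OF 2]]
  have "preferred I = preferred J"
    using 3 encode_nat_prefix_free[of "preferred I" "[]" "preferred J" "[]"] by simp
  with 1 2 3 show "I = J"
    by simp
qed


section \<open>Deterministic multi-tape Turing machines and polynomial time\<close>

datatype move = MoveLeft | Stay | MoveRight

text \<open>
  The states are the numbers below \<open>num_states\<close> and the tape symbols are the numbers below
  \<open>num_symbols\<close>. The function \<open>delta\<close> maps a state and the list of scanned
  symbols (one per tape) to the next state and, for each tape, the symbol to write and the move.
\<close>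

record turing_machine =
  num_tapes :: nat
  num_states :: nat
  num_symbols :: nat
  start_state :: nat
  accept_state :: nat
  reject_state :: nat
  delta :: "nat \<Rightarrow> nat list \<Rightarrow> nat \<times> (nat \<times> move) list"

definition wf_tm :: "turing_machine \<Rightarrow> bool" where
  "wf_tm M \<longleftrightarrow>
     num_tapes M \<ge> 1 \<and>
     start_state M < num_states M \<and>
     accept_state M < num_states M \<and>
     reject_state M < num_states M \<and>
     accept_state M \<noteq> reject_state M \<and>
     0 < num_symbols M \<and>
     (\<forall>q ss. q < num_states M \<longrightarrow> length ss = num_tapes M \<longrightarrow> set ss \<subseteq> {..<num_symbols M} \<longrightarrow>
        (case delta M q ss of (q', acts) \<Rightarrow>
           q' < num_states M \<and> length acts = num_tapes M \<and> fst ` set acts \<subseteq> {..<num_symbols M}))"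

text \<open>
  A tape is infinite in both directions and is given by its contents and the head position.
  Symbol 0 is the blank.
\<close>

type_synonym tape = "(int \<Rightarrow> nat) \<times> int"
type_synonym config = "nat \<times> tape list"

definition scanned :: "tape \<Rightarrow> nat" where
  "scanned = (\<lambda>(f, h). f h)"

definition update_tape :: "nat \<times> move \<Rightarrow> tape \<Rightarrow> tape" where
  "update_tape = (\<lambda>(s, d) (f, h).
     (f(h := s), case d of MoveLeft \<Rightarrow> h - 1 | Stay \<Rightarrow> h | MoveRight \<Rightarrow> h + 1))"

definition tm_step :: "turing_machine \<Rightarrow> config \<Rightarrow> config" where
  "tm_step M = (\<lambda>(q, ts).
     if q = accept_state M \<or> q = reject_state M then (q, ts)
     else case delta M q (map scanned ts) of (q', acts) \<Rightarrow> (q', map2 update_tape acts ts))"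

definition blank_tape :: tape where
  "blank_tape = (\<lambda>_. 0, 0)"

definition input_tape :: "nat list \<Rightarrow> tape" where
  "input_tape x = (\<lambda>i. if 0 \<le> i \<and> i < int (length x) then x ! nat i else 0, 0)"

definition initial_config :: "turing_machine \<Rightarrow> nat list \<Rightarrow> config" where
  "initial_config M x = (start_state M, input_tape x # replicate (num_tapes M - 1) blank_tape)"

definition state_after :: "turing_machine \<Rightarrow> nat list \<Rightarrow> nat \<Rightarrow> nat" where
  "state_after M x t = fst ((tm_step M ^^ t) (initial_config M x))"

text \<open>
  The decision problem with instance set \<open>D\<close>, yes-instances \<open>{I \<in> D. Y I}\<close> and encoding \<open>e\<close>
  is solved by one machine which, on every encoded instance, halts with the right answer after a
  number of steps that is polynomial in the length of the encoding.
\<close>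

definition solvable_in_polynomial_time ::
    "'i set \<Rightarrow> ('i \<Rightarrow> bool) \<Rightarrow> ('i \<Rightarrow> nat list) \<Rightarrow> bool" where
  "solvable_in_polynomial_time D Y e \<longleftrightarrow>
     (\<exists>M a k. wf_tm M \<and>
        (\<forall>I \<in> D. set (e I) \<subseteq> {1..<num_symbols M} \<and>
           (\<exists>t \<le> a * length (e I) ^ k + a.
              state_after M (e I) t = (if Y I then accept_state M else reject_state M))))"

end

theory Submission
  imports Defs
begin

text \<open>
  Under the average-score scheme every plurality ballot gives one point to its first candidate and
  none to the others: the positions averaged over the unranked candidates all have value 0. Hence
  it is optimal for all manipulators to rank \<open>p\<close> first, and \<open>p\<close> can be made a winner iff no
  candidate has more points in the fixed votes than \<open>p\<close> has there together with the total weight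
  of the manipulators. A Turing machine checks this with one pass over the votes per candidate,
  adding binary numbers on a work tape. It is obtained by compiling a structured program whose
  states are the programs that remain to be executed.
\<close>

text \<open>The machine must be one fixed object for inputs with arbitrarily many candidates, votes
  and digits. Names, scores and the bound therefore live on tapes, and the states stay finite
  because a loop body always returns to the same \<open>While\<close>. Weights are binary, so a
  score can be exponential in the input length and is kept as digits. Its length is controlled
  without logarithms: adding a weight lengthens the accumulator by at most the number of digits of
  that weight, and these digits have just left the unread input. So accumulator and unread input
  together never grow; one vote costs linear, one candidate quadratic and the whole run cubic time.
  The constants are generous round numbers instead of exact step counts, which is sound because a
  finished program idles (\<open>exec_mono\<close>).\<close>

section \<open>Structured programs on tapes\<close>

text \<open>
  A tape is split at its head: the first list holds the cells to the left of the head, nearest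
  first, the second one the scanned cell and the cells to its right. All other cells are blank.
\<close>

type_synonym split_tape = "nat list \<times> nat list"

definition read :: "split_tape \<Rightarrow> nat" where
  "read t = (case snd t of [] \<Rightarrow> 0 | x # _ \<Rightarrow> x)"

text \<open>Writing a blank beyond the end leaves the list alone, so that moves never pad it.\<close>

definition put :: "nat \<Rightarrow> nat list \<Rightarrow> nat list" where
  "put s r = (if s = 0 \<and> r = [] then [] else s # tl r)"

text \<open>A right move pushes the written symbol even if it is blank. Such an explicit 0 in the
  left list is the delimiter at which a later \<open>rewind\<close> stops.\<close>

fun act :: "nat \<Rightarrow> move \<Rightarrow> split_tape \<Rightarrow> split_tape" where
  "act s Stay (l, r) = (l, put s r)"
| "act s MoveRight (l, r) = (s # l, tl r)"
| "act s MoveLeft ([], r) = ([], 0 # put s r)"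
| "act s MoveLeft (x # l, r) = (l, x # put s r)"

datatype prog =
    Skip
  | Act nat "nat list \<Rightarrow> nat" move
  | Seq prog prog  (infixr \<open>;;\<close> 60)
  | If "nat list \<Rightarrow> bool" prog prog
  | While "nat list \<Rightarrow> bool" prog

type_synonym action = "(nat \<times> nat \<times> move) option"

text \<open>Control steps, such as testing a condition or dropping a finished \<open>Skip\<close>,
  carry no action but count as steps; they account for the additive 1 and 2 in the execution
  rules.\<close>

fun residual :: "prog \<Rightarrow> nat list \<Rightarrow> prog \<times> action" where
  "residual Skip ss = (Skip, None)"
| "residual (Act i g d) ss = (Skip, Some (i, g ss, d))"
| "residual (c1 ;; c2) ss =
     (if c1 = Skip then (c2, None) else case residual c1 ss of (c, a) \<Rightarrow> (c ;; c2, a))"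
| "residual (If b c1 c2) ss = (if b ss then c1 else c2, None)"
| "residual (While b c) ss = (if b ss then c ;; While b c else Skip, None)"

fun perform :: "action \<Rightarrow> split_tape list \<Rightarrow> split_tape list" where
  "perform None ts = ts"
| "perform (Some (i, s, d)) ts = ts[i := act s d (ts ! i)]"

definition prog_step :: "prog \<times> split_tape list \<Rightarrow> prog \<times> split_tape list" where
  "prog_step = (\<lambda>(c, ts). case residual c (map read ts) of (c', a) \<Rightarrow> (c', perform a ts))"

text \<open>Since \<open>Skip\<close> is its own residual, \<open>n\<close> is an upper bound on the
  running time, not an exact count.\<close>

definition exec :: "prog \<Rightarrow> nat \<Rightarrow> split_tape list \<Rightarrow> split_tape list \<Rightarrow> bool" where
  "exec c n ts ts' \<longleftrightarrow> (prog_step ^^ n) (c, ts) = (Skip, ts')"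

lemma prog_step_Skip [simp]: "(prog_step ^^ n) (Skip, ts) = (Skip, ts)"
  by (induction n) (simp_all add: prog_step_def)

lemma exec_mono:
  assumes "exec c n ts ts'" "n \<le> m"
  shows "exec c m ts ts'"
proof -
  have "(prog_step ^^ ((m - n) + n)) (c, ts) = (Skip, ts')"
    using assms(1) unfolding funpow_add by (simp add: exec_def)
  with assms(2) show ?thesis by (simp add: exec_def)
qed

lemma exec_Suc:
  assumes "prog_step (c, ts) = (c', us)" "exec c' n us vs"
  shows "exec c (Suc n) ts vs"
  using assms by (simp add: exec_def funpow_swap1)

lemma exec_Skip: "exec Skip 0 ts ts"
  by (simp add: exec_def)

lemma exec_Act: "exec (Act i g d) 1 ts (ts[i := act (g (map read ts)) d (ts ! i)])"
  by (simp add: exec_def prog_step_def)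

lemma exec_Seq:
  "exec c1 n ts us \<Longrightarrow> exec c2 m us vs \<Longrightarrow> exec (c1 ;; c2) (n + m + 1) ts vs"
proof (induction n arbitrary: c1 ts)
  case 0
  then have "c1 = Skip" "ts = us" by (simp_all add: exec_def)
  with 0 show ?case
    using exec_Suc[of "Skip ;; c2" us c2 us m vs] by (simp add: prog_step_def)
next
  case (Suc n)
  \<comment> \<open>A positive budget does not mean that \<open>c1\<close> has work left: it may
    already be \<open>Skip\<close>.\<close>
  show ?case
  proof (cases "c1 = Skip")
    case True
    with Suc.prems have "ts = us" by (simp add: exec_def del: funpow.simps)
    with True Suc.prems have "exec (c1 ;; c2) (Suc m) ts vs"
      by (intro exec_Suc) (simp_all add: prog_step_def)
    then show ?thesis by (rule exec_mono) simp
  next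
    case False
    obtain c' us' where s: "prog_step (c1, ts) = (c', us')" by fastforce
    with Suc.prems(1) have "exec c' n us' us" by (simp add: exec_def funpow_swap1)
    from Suc.IH[OF this Suc.prems(2)] have "exec (c' ;; c2) (n + m + 1) us' vs" .
    moreover have "prog_step (c1 ;; c2, ts) = (c' ;; c2, us')"
      using s False by (auto simp: prog_step_def split: prod.splits)
    ultimately show ?thesis
      using exec_Suc by fastforce
  qed
qed

lemma exec_If_True: "b (map read ts) \<Longrightarrow> exec c1 n ts us \<Longrightarrow> exec (If b c1 c2) (Suc n) ts us"
  and exec_If_False: "\<not> b (map read ts) \<Longrightarrow> exec c2 n ts us \<Longrightarrow> exec (If b c1 c2) (Suc n) ts us"
  by (rule exec_Suc; simp add: prog_step_def)+

lemma exec_While_False: "\<not> b (map read ts) \<Longrightarrow> exec (While b c) 1 ts ts"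
  by (simp add: exec_def prog_step_def)

text \<open>The 2 pays for unfolding the loop into \<open>c ;; While b c\<close> and for dropping
  the \<open>Skip\<close> left over from the body.\<close>

lemma exec_While_True:
  assumes "b (map read ts)" "exec c n ts us" "exec (While b c) m us vs"
  shows "exec (While b c) (n + m + 2) ts vs"
  using exec_Suc[OF _ exec_Seq[OF assms(2,3)], of "While b c" ts] assms(1)
  by (simp add: prog_step_def)


section \<open>Compilation to Turing machines\<close>

text \<open>The future states of the machine: an over-approximation of the reachable residuals,
  closed under \<open>residual\<close> in the manner of partial derivatives of a regular
  expression.\<close>

fun residuals :: "prog \<Rightarrow> prog set" where
  "residuals Skip = {Skip}"
| "residuals (Act i g d) = {Act i g d, Skip}"
| "residuals (c1 ;; c2) = (\<lambda>c. c ;; c2) ` residuals c1 \<union> residuals c2"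
| "residuals (If b c1 c2) = {If b c1 c2} \<union> residuals c1 \<union> residuals c2"
| "residuals (While b c) = {While b c, Skip} \<union> (\<lambda>c'. c' ;; While b c) ` residuals c"

lemma finite_residuals: "finite (residuals c)"
  by (induction c) auto

lemma self_in_residuals: "c \<in> residuals c"
  by (induction c) auto

lemma residual_in_residuals:
  "c \<in> residuals P \<Longrightarrow> fst (residual c ss) \<in> residuals P"
proof (induction P arbitrary: c)
  case (Seq c1 c2)
  from Seq.prems consider d where "d \<in> residuals c1" "c = d ;; c2" | "c \<in> residuals c2"
    by auto
  then show ?case
  proof cases
    case 1
    obtain d' a where "residual d ss = (d', a)" by fastforce
    then show ?thesis
      using 1(2) Seq.IH(1)[OF 1(1)] self_in_residuals[of c2] by simp
  qed (use Seq.IH(2) in simp)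
next
  case (If b c1 c2)
  then show ?case
    using self_in_residuals[of c1] self_in_residuals[of c2] by auto
next
  case (While b d)
  from While.prems consider "c = While b d" | "c = Skip" | e where "e \<in> residuals d" "c = e ;; While b d"
    by auto
  then show ?case
  proof cases
    case 1
    then show ?thesis
      using self_in_residuals[of d] by simp
  next
    case 3
    obtain e' a where "residual e ss = (e', a)" by fastforce
    then show ?thesis
      using 3(2) While.IH[OF 3(1)] self_in_residuals[of "While b d"] by simp
  qed simp
qed auto

text \<open>All symbols are below 6: the blank and the five symbols of the encoding.\<close>

definition admissible :: "nat \<Rightarrow> (nat list \<Rightarrow> nat) \<Rightarrow> bool" where
  "admissible K g \<longleftrightarrow> (\<forall>ss. length ss = K \<longrightarrow> set ss \<subseteq> {..<6} \<longrightarrow> g ss < 6)"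

fun wf_prog :: "nat \<Rightarrow> prog \<Rightarrow> bool" where
  "wf_prog K Skip \<longleftrightarrow> True"
| "wf_prog K (Act i g d) \<longleftrightarrow> i < K \<and> admissible K g"
| "wf_prog K (c1 ;; c2) \<longleftrightarrow> wf_prog K c1 \<and> wf_prog K c2"
| "wf_prog K (If b c1 c2) \<longleftrightarrow> wf_prog K c1 \<and> wf_prog K c2"
| "wf_prog K (While b c) \<longleftrightarrow> wf_prog K c"

lemma wf_residuals: "wf_prog K P \<Longrightarrow> residuals P \<subseteq> Collect (wf_prog K)"
proof (induction P)
  case (Seq c1 c2)
  from Seq.IH Seq.prems have "residuals c1 \<subseteq> Collect (wf_prog K)" "residuals c2 \<subseteq> Collect (wf_prog K)"
    by simp_all
  with Seq.prems show ?case by auto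
next
  case (If b c1 c2)
  from If.IH If.prems have "residuals c1 \<subseteq> Collect (wf_prog K)" "residuals c2 \<subseteq> Collect (wf_prog K)"
    by simp_all
  with If.prems show ?case by auto
next
  case (While b c)
  from While.IH While.prems have "residuals c \<subseteq> Collect (wf_prog K)"
    by simp
  with While.prems show ?case by auto
qed simp_all

lemma wf_residual:
  "wf_prog K c \<Longrightarrow> length ss = K \<Longrightarrow> set ss \<subseteq> {..<6} \<Longrightarrow> residual c ss = (c', Some (i, s, d)) \<Longrightarrow>
     i < K \<and> s < 6"
  by (induction c arbitrary: c') (auto simp: admissible_def split: prod.splits if_splits)

text \<open>A machine step acts on every tape. Untouched tapes get their scanned symbol back without
  a move, which is the identity by \<open>update_tape_scanned\<close>.\<close>

definition tm_acts :: "action \<Rightarrow> nat list \<Rightarrow> (nat \<times> move) list" where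
  "tm_acts a ss = (case a of None \<Rightarrow> map (\<lambda>s. (s, Stay)) ss
     | Some (i, s, d) \<Rightarrow> (map (\<lambda>s. (s, Stay)) ss)[i := (s, d)])"

text \<open>The states 0 and 1 are reserved for accepting and rejecting.\<close>

definition state_of :: "prog \<Rightarrow> prog \<Rightarrow> nat" where
  "state_of P = (SOME f. bij_betw f (residuals P) {2..<card (residuals P) + 2})"

text \<open>A program merely ends; the answer is extracted by \<open>acc\<close> from the symbols
  scanned in the state of \<open>Skip\<close>, at the cost of one further step.\<close>

definition compile :: "nat \<Rightarrow> prog \<Rightarrow> (nat list \<Rightarrow> bool) \<Rightarrow> turing_machine" where
  "compile K P acc =
     \<lparr>num_tapes = K, num_states = card (residuals P) + 2, num_symbols = 6,
      start_state = state_of P P, accept_state = 0, reject_state = 1,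
      delta = (\<lambda>q ss. if q < 2 then (q, tm_acts None ss)
        else let c = inv_into (residuals P) (state_of P) q in
          if c = Skip then (if acc ss then 0 else 1, tm_acts None ss)
          else case residual c ss of (c', a) \<Rightarrow> (state_of P c', tm_acts a ss))\<rparr>"

lemma bij_state_of: "bij_betw (state_of P) (residuals P) {2..<card (residuals P) + 2}"
proof -
  have "\<exists>f. bij_betw f (residuals P) {2..<card (residuals P) + 2}"
    by (rule finite_same_card_bij) (auto simp: finite_residuals)
  then show ?thesis
    unfolding state_of_def by (rule someI_ex)
qed

lemma state_of_range:
  "c \<in> residuals P \<Longrightarrow> 2 \<le> state_of P c \<and> state_of P c < card (residuals P) + 2"
  using bij_betwE[OF bij_state_of] by fastforce

lemma inv_state_of:
  "c \<in> residuals P \<Longrightarrow> inv_into (residuals P) (state_of P) (state_of P c) = c"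
  by (rule inv_into_f_f[OF bij_betw_imp_inj_on[OF bij_state_of]])

lemma wf_tm_compile:
  assumes wf: "wf_prog K P" and K: "K \<ge> 1"
  shows "wf_tm (compile K P acc)"
proof -
  have "case delta (compile K P acc) q ss of (q', acts) \<Rightarrow>
      q' < card (residuals P) + 2 \<and> length acts = K \<and> fst ` set acts \<subseteq> {..<6}"
    if q: "q < card (residuals P) + 2" and ss: "length ss = K" "set ss \<subseteq> {..<6}" for q ss
  proof -
    have none: "length (tm_acts None ss) = K" "fst ` set (tm_acts None ss) \<subseteq> {..<6}"
      using ss by (auto simp: tm_acts_def)
    show ?thesis
    proof (cases "q < 2")
      case False
      define c where "c = inv_into (residuals P) (state_of P) q"
      have "q \<in> state_of P ` residuals P"
        using False q bij_state_of[of P] by (auto simp: bij_betw_def)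
      then have c: "c \<in> residuals P"
        unfolding c_def by (rule inv_into_into)
      obtain c' a where r: "residual c ss = (c', a)" by fastforce
      then have "c' \<in> residuals P"
        using residual_in_residuals[OF c, of ss] by simp
      then have c': "state_of P c' < card (residuals P) + 2"
        using state_of_range by blast
      have "length (tm_acts a ss) = K \<and> fst ` set (tm_acts a ss) \<subseteq> {..<6}"
      proof (cases a)
        case (Some isd)
        obtain i s d where isd: "isd = (i, s, d)" by (cases isd)
        have s: "s < 6"
          using wf_residual[OF _ ss] wf_residuals[OF wf] c r Some isd by blast
        have "set ((map (\<lambda>s. (s, Stay)) ss)[i := (s, d)]) \<subseteq> insert (s, d) ((\<lambda>s. (s, Stay)) ` set ss)"
          using set_update_subset_insert[of "map (\<lambda>s. (s, Stay)) ss" i "(s, d)"] by simp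
        then show ?thesis
          using ss s unfolding Some isd tm_acts_def by (auto dest!: subsetD)
      qed (use none in simp)
      then show ?thesis
        using False c' none r by (auto simp: compile_def c_def[symmetric] Let_def)
    qed (use q none in \<open>auto simp: compile_def\<close>)
  qed
  then show ?thesis
    using K state_of_range[OF self_in_residuals, of P]
    by (auto simp: wf_tm_def compile_def)
qed

section \<open>Correspondence between split tapes and infinite tapes\<close>

definition cell :: "nat list \<Rightarrow> nat \<Rightarrow> nat" where
  "cell xs i = (if i < length xs then xs ! i else 0)"

text \<open>A relation, since lists that differ only in trailing blanks describe the same tape.
  Positions are relative to the head, so split tapes carry no coordinates.\<close>

definition represents :: "split_tape \<Rightarrow> tape \<Rightarrow> bool" where
  "represents t T \<longleftrightarrow>
     (\<forall>i. fst T (snd T + int i) = cell (snd t) i) \<and> (\<forall>i. fst T (snd T - 1 - int i) = cell (fst t) i)"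

lemma cell_Nil [simp]: "cell [] i = 0"
  and cell_Cons_0 [simp]: "cell (x # xs) 0 = x"
  and cell_Cons_Suc [simp]: "cell (x # xs) (Suc i) = cell xs i"
  and cell_tl: "cell (tl xs) i = cell xs (Suc i)"
  by (cases xs; simp add: cell_def)+

lemma cell_put: "cell (put s r) i = (if i = 0 then s else cell r i)"
  by (cases i; cases r) (auto simp: put_def)

lemma scanned_represents: "represents t T \<Longrightarrow> scanned T = read t"
  unfolding represents_def scanned_def read_def
  by (cases T; cases "snd t") (auto dest: spec[of _ 0])

lemma represents_act:
  assumes "represents t T"
  shows "represents (act s d t) (update_tape (s, d) T)"
proof -
  obtain f h where T: "T = (f, h)" by fastforce
  obtain l r where t: "t = (l, r)" by fastforce
  have R: "f (h + int i) = cell r i" and L: "f (h - 1 - int i) = cell l i" for i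
    using assms by (simp_all add: represents_def T t)
  show ?thesis
  proof (cases d)
    case Stay
    then show ?thesis
      using R L by (auto simp: represents_def T t update_tape_def cell_put)
  next
    case MoveRight
    have "(f(h := s)) (h + 1 + int i) = cell (tl r) i" for i
      using R[of "Suc i"] by (simp add: cell_tl algebra_simps)
    moreover have "(f(h := s)) (h - int i) = cell (s # l) i" for i
      using L[of "i - 1"] by (cases i) (auto simp: algebra_simps)
    ultimately show ?thesis
      using MoveRight by (simp add: represents_def T t update_tape_def)
  next
    case MoveLeft
    \<comment> \<open>\<open>cell l 0\<close> is the top of \<open>l\<close>, or a blank if
      \<open>l\<close> is empty; this covers both left-move equations of \<open>act\<close>.\<close>
    have "(f(h := s)) (h - 1 + int i) = cell (cell l 0 # put s r) i" for i
      using L[of 0] R[of "i - 1"]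
      by (cases i) (auto simp: cell_put algebra_simps)
    moreover have "(f(h := s)) (h - 1 - 1 - int i) = cell (tl l) i" for i
      using L[of "Suc i"] by (simp add: cell_tl algebra_simps)
    ultimately show ?thesis
      using MoveLeft by (cases l) (simp_all add: represents_def T t update_tape_def)
  qed
qed

lemma update_tape_scanned: "update_tape (scanned T, Stay) T = T"
  by (auto simp: update_tape_def scanned_def split: prod.splits)

lemma represents_perform:
  assumes "list_all2 represents ts Ts"
  shows "list_all2 represents (perform a ts)
    (map2 update_tape (tm_acts a (map read ts)) Ts)"
proof -
  have sc: "map read ts = map scanned Ts"
    using assms by (induction rule: list_all2_induct) (simp_all add: scanned_represents)
  have len: "length ts = length Ts"
    using assms by (rule list_all2_lengthD)
  show ?thesis
    unfolding list_all2_conv_all_nth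
  proof (intro conjI allI impI)
    show "length (perform a ts) = length (map2 update_tape (tm_acts a (map read ts)) Ts)"
      using len by (cases a) (auto simp: tm_acts_def)
    fix j assume "j < length (perform a ts)"
    then have j: "j < length ts" "j < length Ts"
      using len by (cases a; auto)+
    have rep: "represents (ts ! j) (Ts ! j)"
      using assms j by (simp add: list_all2_nthD)
    show "represents (perform a ts ! j) (map2 update_tape (tm_acts a (map read ts)) Ts ! j)"
    proof (cases a)
      case None
      then show ?thesis
        using j rep sc by (simp add: tm_acts_def update_tape_scanned)
    next
      case (Some isd)
      obtain i s d where "isd = (i, s, d)" by (cases isd)
      then show ?thesis
        using j rep sc represents_act[OF rep] Some
        by (cases "i = j") (simp_all add: tm_acts_def update_tape_scanned)
    qed
  qed
qed

text \<open>While the program idles at \<open>Skip\<close>, the machine takes one more step to its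
  verdict; the last disjunct keeps the relation invariant from then on.\<close>

definition simulates :: "prog \<Rightarrow> (nat list \<Rightarrow> bool) \<Rightarrow> prog \<times> split_tape list \<Rightarrow> config \<Rightarrow> bool" where
  "simulates P acc = (\<lambda>(c, ts) (q, Ts). c \<in> residuals P \<and> list_all2 represents ts Ts \<and>
     (q = state_of P c \<or> c = Skip \<and> q = (if acc (map read ts) then 0 else 1)))"

lemma simulates_step:
  assumes "simulates P acc (c, ts) (q, Ts)"
  shows "simulates P acc (prog_step (c, ts)) (tm_step (compile K P acc) (q, Ts))"
    and "c = Skip \<Longrightarrow> fst (tm_step (compile K P acc) (q, Ts)) = (if acc (map read ts) then 0 else 1)"
proof -
  have c: "c \<in> residuals P" and rep: "list_all2 represents ts Ts"
    and q: "q = state_of P c \<or> c = Skip \<and> q = (if acc (map read ts) then 0 else 1)"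
    using assms by (auto simp: simulates_def)
  have sc: "map scanned Ts = map read ts"
    using rep by (induction rule: list_all2_induct) (simp_all add: scanned_represents)
  note none = represents_perform[OF rep, of None, simplified]
  have inv: "inv_into (residuals P) (state_of P) (state_of P c) = c"
    using c by (rule inv_state_of)
  have ge: "2 \<le> state_of P c"
    using state_of_range[OF c] by simp
  show "simulates P acc (prog_step (c, ts)) (tm_step (compile K P acc) (q, Ts))"
  proof (cases "c = Skip")
    case True
    then show ?thesis
      using q ge c rep none inv
      by (auto simp: simulates_def prog_step_def tm_step_def compile_def sc)
  next
    case False
    obtain c' a where r: "residual c (map read ts) = (c', a)" by fastforce
    have c': "c' \<in> residuals P"
      using residual_in_residuals[OF c, of "map read ts"] r by simp
    show ?thesis
      using q False ge c' inv r represents_perform[OF rep, of a]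
      by (auto simp: simulates_def prog_step_def tm_step_def compile_def sc)
  qed
  show "fst (tm_step (compile K P acc) (q, Ts)) = (if acc (map read ts) then 0 else 1)" if "c = Skip"
    using that q ge inv by (auto simp: tm_step_def compile_def sc)
qed

lemma compile_state_after:
  assumes K: "K \<ge> 1" and run: "exec P n (([], x) # replicate (K - 1) ([], [])) ts"
  shows "state_after (compile K P acc) x (Suc n) = (if acc (map read ts) then 0 else 1)"
proof -
  let ?ts = "([], x) # replicate (K - 1) ([], [])"
  have "represents ([], x) (input_tape x)" "represents ([], []) blank_tape"
    by (auto simp: represents_def input_tape_def blank_tape_def cell_def)
  then have init: "simulates P acc (P, ?ts) (initial_config (compile K P acc) x)"
    by (simp add: simulates_def initial_config_def compile_def self_in_residuals
        list_all2_conv_all_nth nth_Cons')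
  have "simulates P acc ((prog_step ^^ k) (P, ?ts))
      ((tm_step (compile K P acc) ^^ k) (initial_config (compile K P acc) x))" for k
  proof (induction k)
    case 0
    show ?case using init by simp
  next
    case (Suc k)
    show ?case
      using simulates_step(1)[of P acc] Suc unfolding funpow.simps(2) comp_apply
      by (metis surj_pair)
  qed
  from this[of n] run have sim: "simulates P acc (Skip, ts)
      ((tm_step (compile K P acc) ^^ n) (initial_config (compile K P acc) x))"
    by (simp add: exec_def)
  obtain q Ts where "(tm_step (compile K P acc) ^^ n) (initial_config (compile K P acc) x) = (q, Ts)"
    by fastforce
  with simulates_step(2)[of P acc Skip ts q Ts K] sim show ?thesis
    by (simp add: state_after_def)
qed


section \<open>Loop-free programs and scanning\<close>

fun loop_free :: "prog \<Rightarrow> bool" where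
  "loop_free (c1 ;; c2) \<longleftrightarrow> loop_free c1 \<and> loop_free c2"
| "loop_free (If b c1 c2) \<longleftrightarrow> loop_free c1 \<and> loop_free c2"
| "loop_free (While b c) \<longleftrightarrow> False"
| "loop_free c \<longleftrightarrow> True"

text \<open>A denotational semantics of straight-line code: the simplifier computes the final tapes
  with it, and \<open>exec_loop_free\<close> turns the result into a timed execution.\<close>

fun effect :: "prog \<Rightarrow> split_tape list \<Rightarrow> split_tape list" where
  "effect (Act i g d) ts = ts[i := act (g (map read ts)) d (ts ! i)]"
| "effect (c1 ;; c2) ts = effect c2 (effect c1 ts)"
| "effect (If b c1 c2) ts = (if b (map read ts) then effect c1 ts else effect c2 ts)"
| "effect c ts = ts"

text \<open>Both branches of an \<open>If\<close> are charged, so the time bound does not depend on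
  the tapes.\<close>

fun prog_size :: "prog \<Rightarrow> nat" where
  "prog_size (c1 ;; c2) = prog_size c1 + prog_size c2 + 1"
| "prog_size (If b c1 c2) = prog_size c1 + prog_size c2 + 1"
| "prog_size c = 1"

lemma exec_effect: "loop_free c \<Longrightarrow> exec c (prog_size c) ts (effect c ts)"
proof (induction c arbitrary: ts)
  case Skip
  show ?case using exec_mono[OF exec_Skip, of 1] by simp
next
  case (If b c1 c2)
  then show ?case
    using exec_mono[OF exec_If_True, of b ts c1 "prog_size c1" "effect c1 ts"]
      exec_mono[OF exec_If_False, of b ts c2 "prog_size c2" "effect c2 ts"]
    by simp
qed (use exec_Act exec_Seq in \<open>fastforce+\<close>)

lemma exec_loop_free:
  "loop_free c \<Longrightarrow> effect c ts = us \<Longrightarrow> prog_size c \<le> n \<Longrightarrow> exec c n ts us"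
  using exec_effect exec_mono by blast

section \<open>Moves, scans and returns to a delimiter\<close>

lemma read_simps [simp]: "read (l, []) = 0" "read (l, x # r) = x"
  by (simp_all add: read_def)

lemma put_simps [simp]:
  "put s (x # r) = s # r" "put 0 [] = []" "s > 0 \<Longrightarrow> put s [] = [s]" "put (read (l, r)) r = r"
  by (cases r; simp add: put_def)+

definition mv :: "nat \<Rightarrow> move \<Rightarrow> prog" where
  "mv i d = Act i (\<lambda>ss. ss ! i) d"

definition scan :: "nat \<Rightarrow> move \<Rightarrow> (nat \<Rightarrow> bool) \<Rightarrow> prog" where
  "scan i d p = While (\<lambda>ss. p (ss ! i)) (mv i d)"

text \<open>The first move leaves the current cell untested, so the head may start on a separator
  that violates \<open>p\<close>. It ends on the cell right after the delimiter, the start of the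
  block.\<close>

definition go_back :: "nat \<Rightarrow> (nat \<Rightarrow> bool) \<Rightarrow> prog" where
  "go_back i p = mv i MoveLeft ;; scan i MoveLeft p ;; mv i MoveRight"

abbreviation rewind :: "nat \<Rightarrow> prog" where
  "rewind i \<equiv> go_back i (\<lambda>s. s \<noteq> 0)"

lemma exec_mv:
  "i < length ts \<Longrightarrow> exec (mv i d) 1 ts (ts[i := act (read (ts ! i)) d (ts ! i)])"
  unfolding mv_def using exec_Act[of i "\<lambda>ss. ss ! i" d ts] by simp

lemma exec_scan_step:
  assumes i: "i < length ts" and p: "p (read (ts ! i))" and t: "act (read (ts ! i)) d (ts ! i) = t"
    and rest: "exec (scan i d p) m (ts[i := t]) us" and n: "m + 3 \<le> n"
  shows "exec (scan i d p) n ts us"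
proof -
  have "exec (scan i d p) (1 + m + 2) ts us"
    unfolding scan_def using exec_mv[OF i, of d] rest i p
    by (intro exec_While_True) (simp_all add: t scan_def)
  then show ?thesis
    by (rule exec_mono) (use n in simp)
qed

lemma exec_scan_stop:
  assumes "i < length ts" "\<not> p (read (ts ! i))"
  shows "exec (scan i d p) 1 ts ts"
  using assms exec_While_False by (simp add: scan_def)

lemma exec_scan_right:
  assumes "i < length ts" "ts ! i = (l, xs @ r)" "\<forall>x \<in> set xs. p x" "\<not> p (read ([], r))"
  shows "exec (scan i MoveRight p) (3 * length xs + 1) ts (ts[i := (rev xs @ l, r)])"
  using assms
proof (induction xs arbitrary: l ts)
  case Nil
  then have "ts[i := (l, r)] = ts" by (metis append_Nil list_update_id)
  moreover have "read (l, r) = read ([], r)" by (simp add: read_def)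
  ultimately show ?case
    using Nil exec_scan_stop[of i ts p] by simp
next
  case (Cons x xs)
  have "exec (scan i MoveRight p) (3 * length xs + 1) (ts[i := (x # l, xs @ r)])
      (ts[i := (rev (x # xs) @ l, r)])"
    using Cons.IH[of "ts[i := (x # l, xs @ r)]" "x # l"] Cons.prems by simp
  then show ?case
    by (rule exec_scan_step[rotated 3]) (use Cons.prems in simp_all)
qed

lemma exec_scan_left:
  assumes "i < length ts" "ts ! i = (xs @ z # l, y # r)" "p y" "\<forall>x \<in> set xs. p x" "\<not> p z"
  shows "exec (scan i MoveLeft p) (3 * length xs + 4) ts (ts[i := (l, z # rev xs @ y # r)])"
  using assms
proof (induction xs arbitrary: ts y r)
  case Nil
  have "exec (scan i MoveLeft p) 1 (ts[i := (l, z # y # r)]) (ts[i := (l, z # rev [] @ y # r)])"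
    using Nil.prems exec_scan_stop[of i "ts[i := (l, z # y # r)]" p] by simp
  then show ?case
    by (rule exec_scan_step[rotated 3]) (use Nil.prems in simp_all)
next
  case (Cons x xs)
  have "exec (scan i MoveLeft p) (3 * length xs + 4) (ts[i := (xs @ z # l, x # y # r)])
      (ts[i := (l, z # rev (x # xs) @ y # r)])"
    using Cons.IH[of "ts[i := (xs @ z # l, x # y # r)]" x "y # r"] Cons.prems by simp
  then show ?case
    by (rule exec_scan_step[rotated 3]) (use Cons.prems in simp_all)
qed

lemma exec_go_back:
  assumes "i < length ts" "ts ! i = (xs @ z # l, r)" "\<forall>x \<in> set xs. p x" "\<not> p z"
  shows "exec (go_back i p) (3 * length xs + 5) ts (ts[i := (z # l, rev xs @ r)])"
proof -
  have "\<exists>us. exec (mv i MoveLeft) 1 ts us \<and>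
      exec (scan i MoveLeft p) (3 * length xs + 1) us (ts[i := (l, z # rev xs @ r)])"
  proof (cases xs)
    case Nil
    have "exec (mv i MoveLeft) 1 ts (ts[i := (l, z # r)])"
      using exec_mv[OF assms(1), of MoveLeft] assms(2) Nil by simp
    moreover have "exec (scan i MoveLeft p) 1 (ts[i := (l, z # r)]) (ts[i := (l, z # r)])"
      unfolding scan_def using assms by (intro exec_While_False) simp
    ultimately show ?thesis using Nil by auto
  next
    case (Cons x xs')
    have "exec (mv i MoveLeft) 1 ts (ts[i := (xs' @ z # l, x # r)])"
      using exec_mv[OF assms(1), of MoveLeft] assms(2) Cons by simp
    moreover have "exec (scan i MoveLeft p) (3 * length xs + 1)
        (ts[i := (xs' @ z # l, x # r)]) (ts[i := (l, z # rev xs @ r)])"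
      using exec_scan_left[of i "ts[i := (xs' @ z # l, x # r)]" xs' z l x r p] assms Cons
      by (auto elim!: exec_mono)
    ultimately show ?thesis
      by blast
  qed
  then obtain us where 1: "exec (mv i MoveLeft) 1 ts us"
    and 2: "exec (scan i MoveLeft p) (3 * length xs + 1) us (ts[i := (l, z # rev xs @ r)])"
    by blast
  have 3: "exec (mv i MoveRight) 1 (ts[i := (l, z # rev xs @ r)]) (ts[i := (z # l, rev xs @ r)])"
    using exec_mv[of i "ts[i := (l, z # rev xs @ r)]" MoveRight] assms(1) by simp
  show ?thesis
    unfolding go_back_def by (rule exec_mono[OF exec_Seq[OF 1 exec_Seq[OF 2 3]]]) simp
qed


section \<open>Binary arithmetic on tapes\<close>

definition is_digit :: "nat \<Rightarrow> bool" where
  "is_digit s \<longleftrightarrow> s = 1 \<or> s = 2"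

definition bit_of :: "nat \<Rightarrow> nat" where
  "bit_of s = (if s = 2 then 1 else 0)"

fun val :: "nat list \<Rightarrow> nat" where
  "val [] = 0"
| "val (d # ds) = bit_of d + 2 * val ds"

abbreviation digits :: "nat list \<Rightarrow> bool" where
  "digits ds \<equiv> list_all is_digit ds"

lemma val_binary_digits: "val (binary_digits n) = n"
  and digits_binary_digits: "digits (binary_digits n)"
proof (induction n rule: less_induct)
  case (less n)
  { case 1
    show ?case
      using less(1)[of "n div 2"] by (subst binary_digits.simps) (auto simp: bit_of_def, presburger) }
  { case 2
    show ?case
      using less(2)[of "n div 2"] by (subst binary_digits.simps) (auto simp: is_digit_def[of "Suc _"]) }
qed

lemma binary_digits_eq_iff: "binary_digits m = binary_digits n \<longleftrightarrow> m = n"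
  using val_binary_digits by metis

lemma val_Cons_read: "val xs = bit_of (read (l, xs)) + 2 * val (tl xs)"
  by (cases xs) (simp_all add: bit_of_def)

text \<open>
  Tape 1 holds the summand, tape 2 the accumulator, and tape 4 the carry \<open>c\<close> as the digit \<open>c + 1\<close>.
\<close>

definition add_loop :: prog where
  "add_loop = While (\<lambda>ss. is_digit (ss ! 1) \<or> ss ! 4 = 2)
     (Act 4 (\<lambda>ss. bit_of (ss ! 1) + bit_of (ss ! 2) + bit_of (ss ! 4) + 1) Stay ;;
      Act 2 (\<lambda>ss. (ss ! 4 - 1) mod 2 + 1) MoveRight ;;
      Act 4 (\<lambda>ss. (ss ! 4 - 1) div 2 + 1) Stay ;;
      If (\<lambda>ss. is_digit (ss ! 1)) (mv 1 MoveRight) Skip)"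

definition add :: prog where
  "add = Act 4 (\<lambda>ss. 1) Stay ;; add_loop ;; rewind 2"

text \<open>Each round emits one digit and lowers \<open>length ws + length bs + bit_of c\<close>,
  which therefore bounds both the rounds and the length of the result. The loop stops once summand
  and carry are used up; \<open>bs'\<close> is the rest of the accumulator, which the head has not
  reached.\<close>

lemma exec_add_loop:
  assumes "digits ws" "digits bs" "is_digit c"
  shows "\<exists>ds bs'. digits ds \<and> digits bs' \<and> val (ds @ bs') = val ws + val bs + bit_of c \<and>
    length (ds @ bs') \<le> length ws + length bs + bit_of c \<and>
    exec add_loop (20 * (length ws + length bs + bit_of c) + 1)
      [X, (l, ws @ 3 # r), (m, bs), A, ([], [c]), G]
      [X, (rev ws @ l, 3 # r), (rev ds @ m, bs'), A, ([], [1]), G]"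
  using assms
proof (induction "length ws + length bs + bit_of c" arbitrary: ws bs c l m rule: less_induct)
  case less
  let ?ts = "[X, (l, ws @ 3 # r), (m, bs), A, ([], [c]), G]"
  show ?case
  proof (cases "ws = [] \<and> c = 1")
    case True
    then have "exec add_loop 1 ?ts ?ts"
      unfolding add_loop_def by (intro exec_While_False) (simp add: is_digit_def)
    then have "exec add_loop (20 * (length ws + length bs + bit_of c) + 1) ?ts ?ts"
      by (rule exec_mono) simp
    with True less.prems show ?thesis
      by (intro exI[of _ "[]"] exI[of _ bs]) (simp add: bit_of_def)
  next
    case False
    \<comment> \<open>The total of one column. An exhausted summand shows 3 and an exhausted
      accumulator a blank; \<open>bit_of\<close> is 0 for both. Tape 4 holds \<open>t + 1\<close>,
      at most 4, until digit and carry have been extracted.\<close>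
    define t where "t = bit_of (read ([], ws)) + bit_of (read ([], bs)) + bit_of c"
    have t: "bit_of (read (l, ws @ 3 # r)) + bit_of (read (m, bs)) + bit_of c = t"
      by (cases ws; cases bs) (simp_all add: t_def bit_of_def)
    have t3: "t \<le> 3" by (simp add: t_def bit_of_def)
    let ?d = "t mod 2 + 1" and ?c = "t div 2 + 1"
    \<comment> \<open>\<open>take 1 ws\<close> and \<open>tl ws\<close> also describe the case where
      the summand is exhausted and the head stays on the closing 3.\<close>
    let ?l = "rev (take 1 ws) @ l"
    let ?us = "[X, (?l, tl ws @ 3 # r), (?d # m, tl bs), A, ([], [?c]), G]"
    have d: "is_digit ?d" and c: "is_digit ?c"
      using t3 by (auto simp: is_digit_def)
    have bit_c: "bit_of ?c = t div 2" and bit_d: "bit_of ?d = t mod 2"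
      using t3 by (auto simp: bit_of_def)
    have decr: "length (tl ws) + length (tl bs) + bit_of ?c < length ws + length bs + bit_of c"
      using False less.prems(3) unfolding bit_c t_def
      by (cases ws; cases bs) (auto simp: bit_of_def is_digit_def)
    have dig: "digits (tl ws)" "digits (tl bs)"
      using less.prems by (cases ws; cases bs; simp)+
    obtain ds bs' where IH: "digits ds" "digits bs'"
      "val (ds @ bs') = val (tl ws) + val (tl bs) + bit_of ?c"
      "length (ds @ bs') \<le> length (tl ws) + length (tl bs) + bit_of ?c"
      "exec add_loop (20 * (length (tl ws) + length (tl bs) + bit_of ?c) + 1) ?us
        [X, (rev (tl ws) @ ?l, 3 # r), (rev ds @ ?d # m, bs'), A, ([], [1]), G]"
      using less.hyps[OF decr dig c, of ?l "?d # m"] by blast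
    have rev_ws: "rev (tl ws) @ ?l = rev ws @ l"
      by (cases ws) simp_all
    have cond: "is_digit (read (l, ws @ 3 # r)) \<longleftrightarrow> ws \<noteq> []"
      using less.prems(1) by (cases ws) (simp_all add: is_digit_def)
    have body: "exec (Act 4 (\<lambda>ss. bit_of (ss ! 1) + bit_of (ss ! 2) + bit_of (ss ! 4) + 1) Stay ;;
      Act 2 (\<lambda>ss. (ss ! 4 - 1) mod 2 + 1) MoveRight ;;
      Act 4 (\<lambda>ss. (ss ! 4 - 1) div 2 + 1) Stay ;;
      If (\<lambda>ss. is_digit (ss ! 1)) (mv 1 MoveRight) Skip) 10 ?ts ?us"
      using t cond
      by (intro exec_loop_free) (cases ws; simp add: mv_def)+
    have "exec add_loop (10 + (20 * (length (tl ws) + length (tl bs) + bit_of ?c) + 1) + 2) ?ts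
        [X, (rev ws @ l, 3 # r), (rev (?d # ds) @ m, bs'), A, ([], [1]), G]"
      unfolding add_loop_def
      by (rule exec_While_True[OF _ body])
        (use False less.prems IH(5)[unfolded rev_ws] cond in \<open>auto simp: add_loop_def is_digit_def[of c]\<close>)
    then have "exec add_loop (20 * (length ws + length bs + bit_of c) + 1) ?ts
        [X, (rev ws @ l, 3 # r), (rev (?d # ds) @ m, bs'), A, ([], [1]), G]"
      by (rule exec_mono) (use decr in simp)
    moreover have "val ((?d # ds) @ bs') = val ws + val bs + bit_of c"
    proof -
      have "val ((?d # ds) @ bs') = t mod 2 + 2 * (val (tl ws) + val (tl bs) + t div 2)"
        by (simp only: append_Cons val.simps IH(3) bit_d bit_c)
      also have "\<dots> = t + 2 * (val (tl ws) + val (tl bs))" by simp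
      finally show ?thesis
        using val_Cons_read[of ws "[]"] val_Cons_read[of bs "[]"] by (simp add: t_def)
    qed
    moreover have "length ((?d # ds) @ bs') \<le> length ws + length bs + bit_of c"
      using IH(4) decr by simp
    ultimately show ?thesis
      using d IH(1,2) by (intro exI[of _ "?d # ds"] exI[of _ bs']) simp
  qed
qed

lemma digits_nonblank: "digits ds \<Longrightarrow> x \<in> set ds \<Longrightarrow> x \<noteq> 0 \<and> x \<noteq> 3 \<and> x \<noteq> 4 \<and> x \<noteq> 5 \<and> is_digit x"
  by (auto simp: list_all_iff is_digit_def)

text \<open>The blank in front of the accumulator is where the head of tape 2 returns to. The head
  of tape 1 stays on the 3 behind the summand, so a list of weights can be added in one
  pass.\<close>

lemma exec_add:
  assumes "digits ws" "digits bs"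
  shows "\<exists>bs'. digits bs' \<and> val bs' = val ws + val bs \<and> length bs' \<le> length ws + length bs \<and>
    exec add (30 * (length ws + length bs) + 10)
      [X, (l, ws @ 3 # r), (0 # m, bs), A, ([], [f]), G]
      [X, (rev ws @ l, 3 # r), (0 # m, bs'), A, ([], [1]), G]"
proof -
  obtain ds bs' where *: "digits ds" "digits bs'" "val (ds @ bs') = val ws + val bs"
    "length (ds @ bs') \<le> length ws + length bs"
    and 2: "exec add_loop (20 * (length ws + length bs) + 1)
      [X, (l, ws @ 3 # r), (0 # m, bs), A, ([], [1]), G]
      [X, (rev ws @ l, 3 # r), (rev ds @ 0 # m, bs'), A, ([], [1]), G]"
    using exec_add_loop[OF assms, of 1 X l r "0 # m" A G] by (auto simp: is_digit_def bit_of_def)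
  have 1: "exec (Act 4 (\<lambda>ss. 1) Stay) 1
      [X, (l, ws @ 3 # r), (0 # m, bs), A, ([], [f]), G]
      [X, (l, ws @ 3 # r), (0 # m, bs), A, ([], [1]), G]"
    by (rule exec_loop_free) simp_all
  have 3: "exec (rewind 2) (3 * length ds + 5)
      [X, (rev ws @ l, 3 # r), (rev ds @ 0 # m, bs'), A, ([], [1]), G]
      [X, (rev ws @ l, 3 # r), (0 # m, ds @ bs'), A, ([], [1]), G]"
    using exec_go_back[of 2 "[X, (rev ws @ l, 3 # r), (rev ds @ 0 # m, bs'), A, ([], [1]), G]" "rev ds" 0]
      digits_nonblank[OF *(1)] by simp
  have "exec add (30 * (length ws + length bs) + 10)
      [X, (l, ws @ 3 # r), (0 # m, bs), A, ([], [f]), G]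
      [X, (rev ws @ l, 3 # r), (0 # m, ds @ bs'), A, ([], [1]), G]"
    unfolding add_def by (rule exec_mono[OF exec_Seq[OF 1 exec_Seq[OF 2 3]]]) (use *(4) in simp)
  with * show ?thesis
    by (intro exI[of _ "ds @ bs'"]) simp
qed

section \<open>Comparing and copying numbers\<close>

definition compare_loop :: prog where
  "compare_loop = While (\<lambda>ss. ss ! 2 \<noteq> 0 \<or> ss ! 3 \<noteq> 0)
     (Act 4 (\<lambda>ss. if bit_of (ss ! 3) < bit_of (ss ! 2) then 2
                  else if bit_of (ss ! 2) < bit_of (ss ! 3) then 1 else ss ! 4) Stay ;;
      If (\<lambda>ss. ss ! 2 \<noteq> 0) (mv 2 MoveRight) Skip ;;
      If (\<lambda>ss. ss ! 3 \<noteq> 0) (mv 3 MoveRight) Skip)"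

definition flag :: "bool \<Rightarrow> nat" where
  "flag P = (if P then 2 else 1)"

text \<open>Digits come least significant first, so the last difference decides and each difference
  overwrites the verdict \<open>c\<close> on the lower positions. The shorter number is padded by
  blanks, which count as zero bits.\<close>

lemma exec_compare_loop:
  assumes "digits bs" "digits cs" "is_digit c"
  shows "exec compare_loop (20 * (length bs + length cs) + 1)
      [X, Y, (l, bs), (m, cs), ([], [c]), G]
      [X, Y, (rev bs @ l, []), (rev cs @ m, []),
        ([], [flag (val cs < val bs \<or> val cs = val bs \<and> c = 2)]), G]"
  using assms
proof (induction "length bs + length cs" arbitrary: bs cs c l m rule: less_induct)
  case less
  let ?ts = "[X, Y, (l, bs), (m, cs), ([], [c]), G]"
  show ?case
  proof (cases "bs = [] \<and> cs = []")
    case True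
    have "flag (c = 2) = c"
      using less.prems(3) by (auto simp: flag_def is_digit_def)
    moreover have "exec compare_loop 1 ?ts ?ts"
      unfolding compare_loop_def by (intro exec_While_False) (simp add: True)
    ultimately show ?thesis
      using True by simp
  next
    case False
    let ?b = "bit_of (read (l, bs))" and ?a = "bit_of (read (m, cs))"
    define e where "e = (if ?a < ?b then 2 else if ?b < ?a then 1 else c)"
    have e: "is_digit e"
      using less.prems(3) by (simp add: e_def is_digit_def)
    have nz: "read (l, bs) \<noteq> 0 \<longleftrightarrow> bs \<noteq> []" "read (m, cs) \<noteq> 0 \<longleftrightarrow> cs \<noteq> []"
      using less.prems by (cases bs; cases cs; simp add: is_digit_def; fastforce)+
    let ?us = "[X, Y, (rev (take 1 bs) @ l, tl bs), (rev (take 1 cs) @ m, tl cs), ([], [e]), G]"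
    let ?f = "flag (val (tl cs) < val (tl bs) \<or> val (tl cs) = val (tl bs) \<and> e = 2)"
    have decr: "length (tl bs) + length (tl cs) < length bs + length cs"
      using False by (cases bs; cases cs; simp)
    have dig: "digits (tl bs)" "digits (tl cs)"
      using less.prems by (cases bs; cases cs; simp)+
    have revs: "rev (tl bs) @ rev (take 1 bs) @ l = rev bs @ l"
      "rev (tl cs) @ rev (take 1 cs) @ m = rev cs @ m"
      by (cases bs; cases cs; simp)+
    have rest: "exec compare_loop (20 * (length (tl bs) + length (tl cs)) + 1) ?us
      [X, Y, (rev bs @ l, []), (rev cs @ m, []), ([], [?f]), G]"
      using less.hyps[OF decr dig e, of "rev (take 1 bs) @ l" "rev (take 1 cs) @ m"]
      unfolding revs .
    have body: "exec (Act 4 (\<lambda>ss. if bit_of (ss ! 3) < bit_of (ss ! 2) then 2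
                  else if bit_of (ss ! 2) < bit_of (ss ! 3) then 1 else ss ! 4) Stay ;;
      If (\<lambda>ss. ss ! 2 \<noteq> 0) (mv 2 MoveRight) Skip ;;
      If (\<lambda>ss. ss ! 3 \<noteq> 0) (mv 3 MoveRight) Skip) 10 ?ts ?us"
      using nz unfolding e_def
      by (intro exec_loop_free) (cases bs; cases cs; simp add: mv_def)+
    have "exec compare_loop (10 + (20 * (length (tl bs) + length (tl cs)) + 1) + 2) ?ts
      [X, Y, (rev bs @ l, []), (rev cs @ m, []), ([], [?f]), G]"
      unfolding compare_loop_def
      by (rule exec_While_True[OF _ body])
        (use False nz rest in \<open>auto simp: compare_loop_def\<close>)
    moreover have "?f = flag (val cs < val bs \<or> val cs = val bs \<and> c = 2)"
    proof -
      have "val bs = ?b + 2 * val (tl bs)" "val cs = ?a + 2 * val (tl cs)" "?a \<le> 1" "?b \<le> 1"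
        using val_Cons_read[of bs l] val_Cons_read[of cs m] by (simp_all add: bit_of_def)
      then show ?thesis
        unfolding e_def by (intro arg_cong[of _ _ flag]) auto
    qed
    ultimately show ?thesis
      using decr by (auto elim!: exec_mono)
  qed
qed

lemma flag_eq_2 [simp]: "flag P = 2 \<longleftrightarrow> P"
  by (simp add: flag_def)

definition copy :: "nat \<Rightarrow> nat \<Rightarrow> prog" where
  "copy i j = While (\<lambda>ss. ss ! i \<noteq> 0) (Act j (\<lambda>ss. ss ! i) MoveRight ;; mv i MoveRight)"

lemma exec_copy:
  assumes "i < length ts" "j < length ts" "i \<noteq> j" "ts ! i = (l, xs)" "ts ! j = (m, [])" "0 \<notin> set xs"
  shows "exec (copy i j) (5 * length xs + 1) ts (ts[i := (rev xs @ l, []), j := (rev xs @ m, [])])"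
  using assms
proof (induction xs arbitrary: l m ts)
  case Nil
  then have "ts[i := (l, []), j := (m, [])] = ts" by (metis list_update_id)
  then show ?case
    using Nil exec_While_False[of "\<lambda>ss. ss ! i \<noteq> 0" ts] by (simp add: copy_def)
next
  case (Cons x xs)
  let ?us = "ts[i := (x # l, xs), j := (x # m, [])]"
  have body: "exec (Act j (\<lambda>ss. ss ! i) MoveRight ;; mv i MoveRight) 3 ts ?us"
    using Cons.prems by (intro exec_loop_free) (simp_all add: mv_def list_update_swap)
  have "?us[i := t, j := t'] = ts[i := t, j := t']" for t t'
    using Cons.prems(3) by (metis list_update_overwrite list_update_swap)
  then have "exec (copy i j) (5 * length xs + 1) ?us
      (ts[i := (rev (x # xs) @ l, []), j := (rev (x # xs) @ m, [])])"
    using Cons.IH[of ?us "x # l" "x # m"] Cons.prems by simp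
  then have "exec (copy i j) (3 + (5 * length xs + 1) + 2) ts
      (ts[i := (rev (x # xs) @ l, []), j := (rev (x # xs) @ m, [])])"
    unfolding copy_def by (intro exec_While_True[OF _ body]) (use Cons.prems in simp_all)
  then show ?case
    by (rule exec_mono) simp
qed


section \<open>The decision procedure\<close>

text \<open>
  Tape 0 holds the input; its head rests on the name of the candidate under consideration.
  Tape 1 holds a copy of the input, which is traversed once per candidate. Tape 2 accumulates the
  score of the candidate; a fresh part of this tape is used each time, so that it need not be
  erased. Tape 3 holds the best possible score of the preferred candidate. Tape 4 holds carries
  and results of comparisons, and tape 5 the verdict. On the tapes 4 and 5 only one cell is used.
\<close>

definition name_loop :: prog where
  "name_loop = While (\<lambda>ss. ss ! 0 = ss ! 1 \<and> ss ! 0 \<noteq> 3) (mv 0 MoveRight ;; mv 1 MoveRight)"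

text \<open>The closing 3 is no digit, so a name that is a proper prefix of the other one also ends
  in a mismatch: the scanned symbols agree exactly if both heads have reached the 3. Only tape 0
  returns, ready for the next vote.\<close>

definition compare_names :: prog where
  "compare_names = name_loop ;; Act 4 (\<lambda>ss. if ss ! 0 = ss ! 1 then 2 else 1) Stay ;;
     go_back 0 is_digit"

definition two_right :: "nat \<Rightarrow> prog" where
  "two_right i = mv i MoveRight ;; mv i MoveRight"

text \<open>The weight precedes the ballot, so it has been passed by the time a match is known. The
  4 opening the ballot serves as the landmark on the way back.\<close>

definition add_weight :: prog where
  "add_weight = go_back 1 (\<lambda>s. s \<noteq> 4) ;; (mv 1 MoveLeft ;; mv 1 MoveLeft) ;; go_back 1 is_digit ;; add"

text \<open>Only the first name of a ballot matters for plurality. With or without the addition, the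
  head is still before the 5 closing the ballot, so one scan reaches the next vote.\<close>

definition process_vote :: prog where
  "process_vote = scan 1 MoveRight is_digit ;; two_right 1 ;; compare_names ;;
     If (\<lambda>ss. ss ! 4 = 2) add_weight Skip ;; scan 1 MoveRight (\<lambda>s. s \<noteq> 5) ;; mv 1 MoveRight"

definition tally_votes :: prog where
  "tally_votes = While (\<lambda>ss. ss ! 1 \<noteq> 5) process_vote"

definition tally :: prog where
  "tally = scan 1 MoveRight (\<lambda>s. s \<noteq> 5) ;; two_right 1 ;; tally_votes"

definition add_weights :: prog where
  "add_weights = While (\<lambda>ss. ss ! 1 \<noteq> 5) (add ;; mv 1 MoveRight)"

text \<open>The right move on tape 2 leaves a fresh blank delimiter behind the used score, while
  tape 3 is rewound because its bound serves all candidates. Tape 5 is only ever changed to 2, so a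
  single rival above the bound settles the verdict.\<close>

definition check_candidate :: prog where
  "check_candidate = tally ;; rewind 1 ;; Act 4 (\<lambda>ss. 1) Stay ;; compare_loop ;; mv 2 MoveRight ;;
     rewind 3 ;; If (\<lambda>ss. ss ! 4 = 2) (Act 5 (\<lambda>ss. 2) Stay) Skip ;;
     scan 0 MoveRight is_digit ;; mv 0 MoveRight"

definition check_candidates :: prog where
  "check_candidates = While (\<lambda>ss. ss ! 0 \<noteq> 5) check_candidate"

text \<open>Creates the blank delimiters in front of tapes 0 to 3. On tape 0 the blank must lie to
  the left of the input, hence the detour to the left.\<close>

definition initialise :: prog where
  "initialise = mv 0 MoveLeft ;; mv 0 MoveRight ;; mv 1 MoveRight ;; mv 2 MoveRight ;;
     mv 3 MoveRight ;; Act 4 (\<lambda>ss. 1) Stay ;; Act 5 (\<lambda>ss. 1) Stay"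

text \<open>The preferred name ends the input, so after copying, the head of tape 0 is just behind
  it and \<open>tally\<close> can be run for it. Tape 1 is then just before the manipulators'
  weights, which complete the bound.\<close>

definition prepare :: prog where
  "prepare = copy 0 1 ;; rewind 1 ;; mv 0 MoveLeft ;; go_back 0 is_digit ;;
     tally ;; two_right 1 ;; add_weights ;; rewind 1 ;;
     copy 2 3 ;; rewind 3 ;; mv 2 MoveRight ;; rewind 0 ;; mv 0 MoveRight"

definition decide :: prog where
  "decide = initialise ;; prepare ;; check_candidates"

lemmas prog_defs = decide_def prepare_def initialise_def check_candidates_def check_candidate_def
  add_weights_def tally_def tally_votes_def process_vote_def add_weight_def two_right_def
  compare_names_def name_loop_def copy_def compare_loop_def add_def add_loop_def go_back_def
  scan_def mv_def

lemma wf_decide: "wf_prog 6 decide"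
proof -
  have sym: "ss ! i < 6" if "length ss = 6" "set ss \<subseteq> {..<6}" "i < 6" for ss :: "nat list" and i
    using that by (metis lessThan_iff nth_mem subsetD)
  have "admissible 6 (\<lambda>ss. ss ! i)" if "i < 6" for i
    using sym that by (simp add: admissible_def)
  moreover have "admissible 6 (\<lambda>ss. k)" if "k < 6" for k
    using that by (simp add: admissible_def)
  moreover have "admissible 6 (\<lambda>ss. (ss ! 4 - 1) div 2 + 1)"
    using sym[of _ 4] by (fastforce simp: admissible_def)
  moreover have "admissible 6 (\<lambda>ss. bit_of (ss ! 1) + bit_of (ss ! 2) + bit_of (ss ! 4) + 1)"
    "admissible 6 (\<lambda>ss. (ss ! 4 - 1) mod 2 + 1)"
    by (auto simp: admissible_def bit_of_def)
  moreover have "admissible 6 (\<lambda>ss. if ss ! 0 = ss ! 1 then 2 else 1)"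
    by (simp add: admissible_def)
  moreover have "admissible 6 (\<lambda>ss. if bit_of (ss ! 3) < bit_of (ss ! 2) then 2
      else if bit_of (ss ! 2) < bit_of (ss ! 3) then 1 else ss ! 4)"
    using sym[of _ 4] by (simp add: admissible_def)
  ultimately show ?thesis
    unfolding prog_defs wf_prog.simps by simp
qed

section \<open>Treatment of a single vote: effect and running time\<close>

lemma exec_name_loop:
  assumes "digits bs" "digits cs"
  shows "\<exists>u v w. bs = u @ v \<and> cs = u @ w \<and>
    (read (rev u @ l0, v @ 3 # r0) = read (rev u @ l1, w @ 3 # r1) \<longleftrightarrow> bs = cs) \<and>
    exec name_loop (5 * length bs + 1)
      [(l0, bs @ 3 # r0), (l1, cs @ 3 # r1), B, A, F, G]
      [(rev u @ l0, v @ 3 # r0), (rev u @ l1, w @ 3 # r1), B, A, F, G]"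
  using assms
proof (induction bs arbitrary: cs l0 l1)
  case Nil
  have "exec name_loop 1 [(l0, 3 # r0), (l1, cs @ 3 # r1), B, A, F, G]
      [(l0, 3 # r0), (l1, cs @ 3 # r1), B, A, F, G]"
    unfolding name_loop_def by (intro exec_While_False) simp
  with Nil.prems show ?case
    by (intro exI[of _ "[]"] exI[of _ cs]) (cases cs; simp add: is_digit_def; fastforce)
next
  case (Cons b bs)
  show ?case
  proof (cases "cs \<noteq> [] \<and> hd cs = b")
    case True
    then obtain cs' where cs: "cs = b # cs'" by (cases cs) auto
    obtain u v w where IH: "bs = u @ v" "cs' = u @ w"
      "read (rev u @ b # l0, v @ 3 # r0) = read (rev u @ b # l1, w @ 3 # r1) \<longleftrightarrow> bs = cs'"
      "exec name_loop (5 * length bs + 1)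
        [(b # l0, bs @ 3 # r0), (b # l1, cs' @ 3 # r1), B, A, F, G]
        [(rev u @ b # l0, v @ 3 # r0), (rev u @ b # l1, w @ 3 # r1), B, A, F, G]"
      using Cons.IH[of cs' "b # l0" "b # l1"] Cons.prems unfolding cs list.pred_inject by blast
    have body: "exec (mv 0 MoveRight ;; mv 1 MoveRight) 3
        [(l0, (b # bs) @ 3 # r0), (l1, cs @ 3 # r1), B, A, F, G]
        [(b # l0, bs @ 3 # r0), (b # l1, cs' @ 3 # r1), B, A, F, G]"
      by (rule exec_loop_free) (simp_all add: mv_def cs)
    have "exec name_loop (3 + (5 * length bs + 1) + 2)
        [(l0, (b # bs) @ 3 # r0), (l1, cs @ 3 # r1), B, A, F, G]
        [(rev u @ b # l0, v @ 3 # r0), (rev u @ b # l1, w @ 3 # r1), B, A, F, G]"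
      unfolding name_loop_def
      by (rule exec_While_True[OF _ body])
        (use Cons.prems cs IH(4) in \<open>auto simp: name_loop_def is_digit_def\<close>)
    then have "exec name_loop (5 * length (b # bs) + 1)
        [(l0, (b # bs) @ 3 # r0), (l1, cs @ 3 # r1), B, A, F, G]
        [(rev u @ b # l0, v @ 3 # r0), (rev u @ b # l1, w @ 3 # r1), B, A, F, G]"
      by (rule exec_mono) simp
    then show ?thesis
      using IH(1-3) cs by (intro exI[of _ "b # u"] exI[of _ v] exI[of _ w]) simp
  next
    case False
    have ne: "b \<noteq> read (l1, cs @ 3 # r1)"
      using False Cons.prems by (cases cs) (auto simp: is_digit_def)
    then have "exec name_loop 1 [(l0, (b # bs) @ 3 # r0), (l1, cs @ 3 # r1), B, A, F, G]
        [(l0, (b # bs) @ 3 # r0), (l1, cs @ 3 # r1), B, A, F, G]"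
      unfolding name_loop_def by (intro exec_While_False) simp
    then have "exec name_loop (5 * length (b # bs) + 1)
        [(l0, (b # bs) @ 3 # r0), (l1, cs @ 3 # r1), B, A, F, G]
        [(l0, (b # bs) @ 3 # r0), (l1, cs @ 3 # r1), B, A, F, G]"
      by (rule exec_mono) simp
    with ne False show ?thesis
      by (intro exI[of _ "[]"] exI[of _ "b # bs"] exI[of _ cs]) auto
  qed
qed

text \<open>\<open>d\<close> precedes the name on tape 0: it is 4 for the first candidate, 3 for a
  later one and 5 for the preferred name at the end of the input. Being no digit, it stops
  \<open>go_back\<close>.\<close>

lemma exec_compare_names:
  assumes "digits bs" "digits cs" "\<not> is_digit d"
  shows "\<exists>u w. cs = u @ w \<and> exec compare_names (10 * length bs + 20)
      [(d # l0, bs @ 3 # r0), (l1, cs @ 3 # r1), B, A, ([], [f]), G]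
      [(d # l0, bs @ 3 # r0), (rev u @ l1, w @ 3 # r1), B, A, ([], [flag (bs = cs)]), G]"
proof -
  obtain u v w where uvw: "bs = u @ v" "cs = u @ w"
    and eq: "read (rev u @ d # l0, v @ 3 # r0) = read (rev u @ l1, w @ 3 # r1) \<longleftrightarrow> bs = cs"
    and 1: "exec name_loop (5 * length bs + 1)
      [(d # l0, bs @ 3 # r0), (l1, cs @ 3 # r1), B, A, ([], [f]), G]
      [(rev u @ d # l0, v @ 3 # r0), (rev u @ l1, w @ 3 # r1), B, A, ([], [f]), G]"
    using exec_name_loop[OF assms(1,2), where ?l0.0 = "d # l0" and ?r0.0 = r0 and ?l1.0 = l1 and
        ?r1.0 = r1 and B = B and A = A and F = "([], [f])" and G = G]
    by blast
  have u: "digits u" using assms(1) uvw(1) by simp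
  have 2: "exec (Act 4 (\<lambda>ss. if ss ! 0 = ss ! 1 then 2 else 1) Stay) 1
      [(rev u @ d # l0, v @ 3 # r0), (rev u @ l1, w @ 3 # r1), B, A, ([], [f]), G]
      [(rev u @ d # l0, v @ 3 # r0), (rev u @ l1, w @ 3 # r1), B, A, ([], [flag (bs = cs)]), G]"
    using eq by (intro exec_loop_free) (simp_all add: flag_def)
  have 3: "exec (go_back 0 is_digit) (3 * length u + 5)
      [(rev u @ d # l0, v @ 3 # r0), (rev u @ l1, w @ 3 # r1), B, A, ([], [flag (bs = cs)]), G]
      [(d # l0, bs @ 3 # r0), (rev u @ l1, w @ 3 # r1), B, A, ([], [flag (bs = cs)]), G]"
    using exec_go_back[of 0 "[(rev u @ d # l0, v @ 3 # r0), (rev u @ l1, w @ 3 # r1), B, A,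
      ([], [flag (bs = cs)]), G]" "rev u" d] assms(3) digits_nonblank[OF u]
    by (simp add: uvw(1))
  have "exec compare_names (10 * length bs + 20)
      [(d # l0, bs @ 3 # r0), (l1, cs @ 3 # r1), B, A, ([], [f]), G]
      [(d # l0, bs @ 3 # r0), (rev u @ l1, w @ 3 # r1), B, A, ([], [flag (bs = cs)]), G]"
    unfolding compare_names_def
    by (rule exec_mono[OF exec_Seq[OF 1 exec_Seq[OF 2 3]]]) (simp add: uvw(1))
  with uvw(2) show ?thesis by blast
qed

lemma exec_add_weight:
  assumes "digits ws" "digits cs" "digits as" "\<not> is_digit e"
  shows "\<exists>as'. digits as' \<and> val as' = val as + val ws \<and> length as' \<le> length as + length ws \<and>
    exec add_weight (40 * (length ws + length cs + length as) + 40)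
      [X, (rev cs @ 4 # 3 # rev ws @ e # l, r), (0 # m, as), A, ([], [f]), G]
      [X, (rev ws @ e # l, 3 # 4 # cs @ r), (0 # m, as'), A, ([], [1]), G]"
proof -
  obtain as' where as': "digits as'" "val as' = val ws + val as" "length as' \<le> length ws + length as"
    and 4: "exec add (30 * (length ws + length as) + 10)
      [X, (e # l, ws @ 3 # 4 # cs @ r), (0 # m, as), A, ([], [f]), G]
      [X, (rev ws @ e # l, 3 # 4 # cs @ r), (0 # m, as'), A, ([], [1]), G]"
    using exec_add[OF assms(1,3), where X = X and l = "e # l" and r = "4 # cs @ r" and m = m and
        A = A and f = f and G = G]
    by blast
  have 1: "exec (go_back 1 (\<lambda>s. s \<noteq> 4)) (3 * length cs + 5)
      [X, (rev cs @ 4 # 3 # rev ws @ e # l, r), (0 # m, as), A, ([], [f]), G]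
      [X, (4 # 3 # rev ws @ e # l, cs @ r), (0 # m, as), A, ([], [f]), G]"
    using exec_go_back[of 1 "[X, (rev cs @ 4 # 3 # rev ws @ e # l, r), (0 # m, as), A, ([], [f]), G]"
      "rev cs" 4] digits_nonblank[OF assms(2)] by simp
  have 2: "exec (mv 1 MoveLeft ;; mv 1 MoveLeft) 3
      [X, (4 # 3 # rev ws @ e # l, cs @ r), (0 # m, as), A, ([], [f]), G]
      [X, (rev ws @ e # l, 3 # 4 # cs @ r), (0 # m, as), A, ([], [f]), G]"
    by (rule exec_loop_free) (simp_all add: mv_def)
  have 3: "exec (go_back 1 is_digit) (3 * length ws + 5)
      [X, (rev ws @ e # l, 3 # 4 # cs @ r), (0 # m, as), A, ([], [f]), G]
      [X, (e # l, ws @ 3 # 4 # cs @ r), (0 # m, as), A, ([], [f]), G]"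
    using exec_go_back[of 1 "[X, (rev ws @ e # l, 3 # 4 # cs @ r), (0 # m, as), A, ([], [f]), G]"
      "rev ws" e] digits_nonblank[OF assms(1)] assms(4) by simp
  have "exec add_weight (40 * (length ws + length cs + length as) + 40)
      [X, (rev cs @ 4 # 3 # rev ws @ e # l, r), (0 # m, as), A, ([], [f]), G]
      [X, (rev ws @ e # l, 3 # 4 # cs @ r), (0 # m, as'), A, ([], [1]), G]"
    unfolding add_weight_def
    by (rule exec_mono[OF exec_Seq[OF 1 exec_Seq[OF 2 exec_Seq[OF 3 4]]]]) simp
  with as' show ?thesis
    by (intro exI[of _ as']) simp
qed

text \<open>\<open>e\<close> precedes the weight: it is 4 for the first vote and 5 for a later one.
  \<open>rest\<close> holds the names after the first one.\<close>

lemma exec_process_vote: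
  assumes "digits bs" "digits ws" "digits cs" "digits as"
    and d: "\<not> is_digit d" and e: "\<not> is_digit e" and rest: "5 \<notin> set rest"
  shows "\<exists>as' f'. digits as' \<and> val as' = val as + (if bs = cs then val ws else 0) \<and>
    length as' \<le> length as + length ws \<and>
    exec process_vote (100 * (length bs + length ws + length cs + length rest + length as) + 200)
      [(d # l0, bs @ 3 # r0), (e # l, ws @ 3 # 4 # cs @ 3 # rest @ 5 # r), (0 # m, as), A, ([], [f]), G]
      [(d # l0, bs @ 3 # r0), (5 # rev (ws @ 3 # 4 # cs @ 3 # rest) @ e # l, r), (0 # m, as'), A,
        ([], [f']), G]"
proof -
  let ?S = "\<lambda>t B F. [(d # l0, bs @ 3 # r0), t, B, A, ([], [F]), G]"
  obtain u w where cs: "cs = u @ w"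
    and 3: "exec compare_names (10 * length bs + 20)
      (?S (4 # 3 # rev ws @ e # l, cs @ 3 # rest @ 5 # r) (0 # m, as) f)
      (?S (rev u @ 4 # 3 # rev ws @ e # l, w @ 3 # rest @ 5 # r) (0 # m, as) (flag (bs = cs)))"
    using exec_compare_names[OF assms(1,3) d, where ?l0.0 = l0 and ?r0.0 = r0 and
        ?l1.0 = "4 # 3 # rev ws @ e # l" and ?r1.0 = "rest @ 5 # r" and B = "(0 # m, as)" and A = A and
        f = f and G = G]
    by blast
  have 1: "exec (scan 1 MoveRight is_digit) (3 * length ws + 1)
      (?S (e # l, ws @ 3 # 4 # cs @ 3 # rest @ 5 # r) (0 # m, as) f)
      (?S (rev ws @ e # l, 3 # 4 # cs @ 3 # rest @ 5 # r) (0 # m, as) f)"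
    using exec_scan_right[of 1 "?S (e # l, ws @ 3 # 4 # cs @ 3 # rest @ 5 # r) (0 # m, as) f"
      "e # l" ws "3 # 4 # cs @ 3 # rest @ 5 # r" is_digit] digits_nonblank[OF assms(2)]
    by (simp add: is_digit_def)
  have 2: "exec (two_right 1) 3
      (?S (rev ws @ e # l, 3 # 4 # cs @ 3 # rest @ 5 # r) (0 # m, as) f)
      (?S (4 # 3 # rev ws @ e # l, cs @ 3 # rest @ 5 # r) (0 # m, as) f)"
    by (rule exec_loop_free) (simp_all add: two_right_def mv_def)
  \<comment> \<open>\<open>p\<close> and \<open>q\<close> split the vote at the head of tape 1.
    After an addition the head is behind the weight, otherwise within or just behind the digits of
    the first name; in both cases no 5 precedes the closing one.\<close>
  have "\<exists>p q as' f'. p @ q = ws @ 3 # 4 # cs @ 3 # rest \<and> 5 \<notin> set q \<and>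
    digits as' \<and> val as' = val as + (if bs = cs then val ws else 0) \<and>
    length as' \<le> length as + length ws \<and>
    exec (If (\<lambda>ss. ss ! 4 = 2) add_weight Skip) (40 * (length ws + length cs + length as) + 41)
      (?S (rev u @ 4 # 3 # rev ws @ e # l, w @ 3 # rest @ 5 # r) (0 # m, as) (flag (bs = cs)))
      (?S (rev p @ e # l, q @ 5 # r) (0 # m, as') f')"
  proof (cases "bs = cs")
    case True
    have u: "digits u" using assms(3) cs by simp
    obtain as' where as': "digits as'" "val as' = val as + val ws" "length as' \<le> length as + length ws"
      and ex: "exec add_weight (40 * (length ws + length u + length as) + 40)
        (?S (rev u @ 4 # 3 # rev ws @ e # l, w @ 3 # rest @ 5 # r) (0 # m, as) 2)
        (?S (rev ws @ e # l, 3 # 4 # u @ w @ 3 # rest @ 5 # r) (0 # m, as') 1)"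
      using exec_add_weight[OF assms(2) u assms(4) e, where X = "(d # l0, bs @ 3 # r0)" and l = l and
          r = "w @ 3 # rest @ 5 # r" and m = m and A = A and f = 2 and G = G]
      by blast
    have "exec (If (\<lambda>ss. ss ! 4 = 2) add_weight Skip) (40 * (length ws + length cs + length as) + 41)
      (?S (rev u @ 4 # 3 # rev ws @ e # l, w @ 3 # rest @ 5 # r) (0 # m, as) (flag (bs = cs)))
      (?S (rev ws @ e # l, (3 # 4 # cs @ 3 # rest) @ 5 # r) (0 # m, as') 1)"
      by (rule exec_mono[OF exec_If_True[where n = "40 * (length ws + length u + length as) + 40"]])
        (use True ex cs in \<open>simp_all add: flag_def\<close>)
    then show ?thesis
      using as' True rest digits_nonblank[OF assms(3)]
      by (intro exI[of _ ws] exI[of _ "3 # 4 # cs @ 3 # rest"] exI[of _ as'] exI[of _ 1]) auto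
  next
    case False
    have "exec (If (\<lambda>ss. ss ! 4 = 2) add_weight Skip) (40 * (length ws + length cs + length as) + 41)
      (?S (rev u @ 4 # 3 # rev ws @ e # l, w @ 3 # rest @ 5 # r) (0 # m, as) (flag (bs = cs)))
      (?S (rev (ws @ 3 # 4 # u) @ e # l, (w @ 3 # rest) @ 5 # r) (0 # m, as) (flag (bs = cs)))"
      by (rule exec_mono[OF exec_If_False[where n = 0]])
        (use False exec_Skip in \<open>simp_all add: flag_def\<close>)
    then show ?thesis
      using False rest assms digits_nonblank[OF assms(3)]
      by (intro exI[of _ "ws @ 3 # 4 # u"] exI[of _ "w @ 3 # rest"] exI[of _ as]
          exI[of _ "flag (bs = cs)"]) (auto simp: cs)
  qed
  then obtain p q as' f' where pq: "p @ q = ws @ 3 # 4 # cs @ 3 # rest" "5 \<notin> set q"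
    and as': "digits as'" "val as' = val as + (if bs = cs then val ws else 0)"
      "length as' \<le> length as + length ws"
    and 4: "exec (If (\<lambda>ss. ss ! 4 = 2) add_weight Skip) (40 * (length ws + length cs + length as) + 41)
      (?S (rev u @ 4 # 3 # rev ws @ e # l, w @ 3 # rest @ 5 # r) (0 # m, as) (flag (bs = cs)))
      (?S (rev p @ e # l, q @ 5 # r) (0 # m, as') f')"
    by blast
  have rev_pq: "rev q @ rev p = rev (ws @ 3 # 4 # cs @ 3 # rest)"
    unfolding pq(1)[symmetric] by simp
  have len: "length q \<le> length ws + length cs + length rest + 3"
    using arg_cong[OF pq(1), of length] by simp
  have 5: "exec (scan 1 MoveRight (\<lambda>s. s \<noteq> 5)) (3 * length q + 1)
      (?S (rev p @ e # l, q @ 5 # r) (0 # m, as') f')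
      (?S (rev q @ rev p @ e # l, 5 # r) (0 # m, as') f')"
    using exec_scan_right[of 1 "?S (rev p @ e # l, q @ 5 # r) (0 # m, as') f'"
      "rev p @ e # l" q "5 # r" "\<lambda>s. s \<noteq> 5"] pq(2) by auto
  have 6: "exec (mv 1 MoveRight) 1
      (?S (rev q @ rev p @ e # l, 5 # r) (0 # m, as') f')
      (?S (5 # (rev q @ rev p) @ e # l, r) (0 # m, as') f')"
    by (rule exec_loop_free) (simp_all add: mv_def)
  have "exec process_vote (100 * (length bs + length ws + length cs + length rest + length as) + 200)
      (?S (e # l, ws @ 3 # 4 # cs @ 3 # rest @ 5 # r) (0 # m, as) f)
      (?S (5 # (rev q @ rev p) @ e # l, r) (0 # m, as') f')"
    unfolding process_vote_def
    by (rule exec_mono[OF exec_Seq[OF 1 exec_Seq[OF 2 exec_Seq[OF 3 exec_Seq[OF 4 exec_Seq[OF 5 6]]]]]])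
      (use len in simp)
  with as' show ?thesis
    unfolding rev_pq by blast
qed

lemma length_encode_nat: "length (encode_nat n) = length (binary_digits n) + 1"
  by (simp add: encode_nat_def)

section \<open>Tallies over lists of votes and weights\<close>

definition points :: "(nat \<times> nat list) list \<Rightarrow> nat \<Rightarrow> nat" where
  "points vs c = (\<Sum>(w, b)\<leftarrow>vs. if hd b = c then w else 0)"

lemma encode_symbols:
  "set (encode_nat n) \<subseteq> {1,2,3}"
  "set (concat (map encode_nat ns)) \<subseteq> {1,2,3}"
proof -
  show "set (encode_nat n) \<subseteq> {1,2,3}" for n
    using digits_binary_digits[of n] by (auto simp: encode_nat_def list_all_iff is_digit_def)
  then show "set (concat (map encode_nat ns)) \<subseteq> {1,2,3}"
    by fastforce
qed

text \<open>\<open>N\<close> bounds the name, the accumulator and the unread votes together. This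
  total does not grow from round to round, so all rounds are charged alike.\<close>

lemma exec_tally_votes:
  assumes "\<forall>(w, b) \<in> set vs. b \<noteq> []" "digits as" "\<not> is_digit d" "\<not> is_digit e"
    and "length (binary_digits c) + length as + length (concat (map encode_vote vs)) \<le> N"
  shows "\<exists>as' f'. digits as' \<and> val as' = val as + points vs c \<and>
    length as' \<le> length as + length (concat (map encode_vote vs)) \<and>
    exec tally_votes (length vs * (100 * N + 202) + 1)
      [(d # l0, encode_nat c @ r0), (e # l, concat (map encode_vote vs) @ 5 # r), (0 # m, as), A,
        ([], [f]), G]
      [(d # l0, encode_nat c @ r0), (rev (concat (map encode_vote vs)) @ e # l, 5 # r), (0 # m, as'), A,
        ([], [f']), G]"
  using assms
proof (induction vs arbitrary: as e l f)
  case Nil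
  have "exec tally_votes 1
      [(d # l0, encode_nat c @ r0), (e # l, 5 # r), (0 # m, as), A, ([], [f]), G]
      [(d # l0, encode_nat c @ r0), (e # l, 5 # r), (0 # m, as), A, ([], [f]), G]"
    unfolding tally_votes_def by (rule exec_While_False) simp
  with Nil.prems show ?case
    by (auto simp: points_def)
next
  case (Cons v vs)
  let ?S = "\<lambda>t B F. [(d # l0, encode_nat c @ r0), t, B, A, ([], [F]), G]"
  obtain w b where v: "v = (w, b)" by fastforce
  with Cons.prems(1) obtain h hs where b: "b = h # hs" by (cases b) auto
  let ?rest = "concat (map encode_nat hs)" and ?tail = "concat (map encode_vote vs)"
  have enc: "encode_vote v = binary_digits w @ 3 # 4 # binary_digits h @ 3 # ?rest @ [5]"
    by (simp add: v b encode_vote_def encode_list_def encode_nat_def)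
  have rest: "5 \<notin> set ?rest"
    using encode_symbols(2)[of hs] by auto
  obtain as1 f1 where as1: "digits as1" "val as1 = val as + (if hd b = c then w else 0)"
      "length as1 \<le> length as + length (binary_digits w)"
    and one: "exec process_vote (100 * (length (binary_digits c) + length (binary_digits w) +
        length (binary_digits h) + length ?rest + length as) + 200)
      (?S (e # l, encode_vote v @ ?tail @ 5 # r) (0 # m, as) f)
      (?S (rev (encode_vote v) @ e # l, ?tail @ 5 # r) (0 # m, as1) f1)"
    using exec_process_vote[OF digits_binary_digits digits_binary_digits digits_binary_digits
        Cons.prems(2,3,4) rest, of c h w l0 r0 l "?tail @ 5 # r" m A f G]
    by (auto simp: enc encode_nat_def binary_digits_eq_iff val_binary_digits b)
  \<comment> \<open>Exhibits the 5 closing this vote as the non-digit in front of the next weight,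
    the \<open>e\<close> of the induction hypothesis.\<close>
  have rev_enc: "rev (encode_vote v) @ e # l = 5 # tl (rev (encode_vote v)) @ e # l"
    by (simp add: enc)
  have len: "length (binary_digits c) + length as1 + length ?tail \<le> N"
    using as1(3) Cons.prems(5) by (simp add: enc)
  have ne: "\<forall>(w, b) \<in> set vs. b \<noteq> []" and five: "\<not> is_digit 5"
    using Cons.prems(1) by (simp_all add: is_digit_def)
  obtain as' f' where as': "digits as'" "val as' = val as1 + points vs c"
      "length as' \<le> length as1 + length ?tail"
    and more: "exec tally_votes (length vs * (100 * N + 202) + 1)
      (?S (rev (encode_vote v) @ e # l, ?tail @ 5 # r) (0 # m, as1) f1)
      (?S (rev ?tail @ rev (encode_vote v) @ e # l, 5 # r) (0 # m, as') f')"
    unfolding rev_enc using Cons.IH[OF ne as1(1) Cons.prems(3) five len,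
        where l = "tl (rev (encode_vote v)) @ e # l" and f = f1]
    by blast
  have one': "exec process_vote (100 * N + 200)
      (?S (e # l, encode_vote v @ ?tail @ 5 # r) (0 # m, as) f)
      (?S (rev (encode_vote v) @ e # l, ?tail @ 5 # r) (0 # m, as1) f1)"
    by (rule exec_mono[OF one]) (use Cons.prems(5) in \<open>simp add: enc\<close>)
  have "exec tally_votes (100 * N + 200 + (length vs * (100 * N + 202) + 1) + 2)
      (?S (e # l, encode_vote v @ ?tail @ 5 # r) (0 # m, as) f)
      (?S (rev ?tail @ rev (encode_vote v) @ e # l, 5 # r) (0 # m, as') f')"
    unfolding tally_votes_def
    by (rule exec_While_True[OF _ one' more[unfolded tally_votes_def]])
      (use encode_vote_Cons[of v] in auto)
  then have "exec tally_votes (length (v # vs) * (100 * N + 202) + 1)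
      (?S (e # l, concat (map encode_vote (v # vs)) @ 5 # r) (0 # m, as) f)
      (?S (rev (concat (map encode_vote (v # vs))) @ e # l, 5 # r) (0 # m, as') f')"
    by (auto elim!: exec_mono)
  moreover have "val as' = val as + points (v # vs) c"
    using as'(2) as1(2) by (simp add: points_def v)
  moreover have "length as' \<le> length as + length (concat (map encode_vote (v # vs)))"
    using as'(3) as1(3) by (simp add: enc)
  ultimately show ?case
    using as'(1) by blast
qed

lemma exec_add_weights:
  assumes "digits as" "length as + length (concat (map encode_nat ws)) \<le> N"
  shows "\<exists>as' f'. digits as' \<and> val as' = val as + sum_list ws \<and>
    length as' \<le> length as + length (concat (map encode_nat ws)) \<and>
    exec add_weights (length ws * (30 * N + 20) + 1)
      [X, (l, concat (map encode_nat ws) @ 5 # r), (0 # m, as), A, ([], [f]), G]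
      [X, (rev (concat (map encode_nat ws)) @ l, 5 # r), (0 # m, as'), A, ([], [f']), G]"
  using assms
proof (induction ws arbitrary: as l f)
  case Nil
  have "exec add_weights 1 [X, (l, 5 # r), (0 # m, as), A, ([], [f]), G]
      [X, (l, 5 # r), (0 # m, as), A, ([], [f]), G]"
    unfolding add_weights_def by (rule exec_While_False) simp
  with Nil.prems show ?case by auto
next
  case (Cons w ws)
  let ?S = "\<lambda>t B F. [X, t, B, A, ([], [F]), G]"
  let ?tail = "concat (map encode_nat ws)"
  obtain as1 where as1: "digits as1" "val as1 = w + val as"
      "length as1 \<le> length (binary_digits w) + length as"
    and 1: "exec add (30 * (length (binary_digits w) + length as) + 10)
      (?S (l, encode_nat w @ ?tail @ 5 # r) (0 # m, as) f)
      (?S (rev (binary_digits w) @ l, 3 # ?tail @ 5 # r) (0 # m, as1) 1)"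
    using exec_add[OF digits_binary_digits Cons.prems(1), of w X l "?tail @ 5 # r" m A f G]
    by (auto simp: encode_nat_def val_binary_digits)
  have 2: "exec (mv 1 MoveRight) 1
      (?S (rev (binary_digits w) @ l, 3 # ?tail @ 5 # r) (0 # m, as1) 1)
      (?S (rev (encode_nat w) @ l, ?tail @ 5 # r) (0 # m, as1) 1)"
    by (rule exec_loop_free) (simp_all add: mv_def encode_nat_def)
  have len: "length as1 + length ?tail \<le> N"
    using as1(3) Cons.prems(2) by (simp add: length_encode_nat)
  obtain as' f' where as': "digits as'" "val as' = val as1 + sum_list ws"
      "length as' \<le> length as1 + length ?tail"
    and more: "exec add_weights (length ws * (30 * N + 20) + 1)
      (?S (rev (encode_nat w) @ l, ?tail @ 5 # r) (0 # m, as1) 1)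
      (?S (rev ?tail @ rev (encode_nat w) @ l, 5 # r) (0 # m, as') f')"
    using Cons.IH[OF as1(1) len, where l = "rev (encode_nat w) @ l" and f = 1] by blast
  have "exec add_weights ((30 * (length (binary_digits w) + length as) + 10 + 1 + 1) +
        (length ws * (30 * N + 20) + 1) + 2)
      (?S (l, encode_nat w @ ?tail @ 5 # r) (0 # m, as) f)
      (?S (rev ?tail @ rev (encode_nat w) @ l, 5 # r) (0 # m, as') f')"
    unfolding add_weights_def
    by (rule exec_While_True[OF _ exec_Seq[OF 1 2] more[unfolded add_weights_def]])
      (use encode_nat_Cons[of w] in auto)
  then have "exec add_weights (length (w # ws) * (30 * N + 20) + 1)
      (?S (l, concat (map encode_nat (w # ws)) @ 5 # r) (0 # m, as) f)
      (?S (rev (concat (map encode_nat (w # ws))) @ l, 5 # r) (0 # m, as') f')"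
    using Cons.prems(2) by (auto elim!: exec_mono simp: length_encode_nat)
  with as' as1 show ?case
    by (intro exI[of _ as'] exI[of _ f']) (simp add: length_encode_nat)
qed

text \<open>Bounds the number of rounds of a loop over a list by the length of its encoding.\<close>

lemma length_concat_map_ge:
  assumes "\<And>x. f x \<noteq> []"
  shows "length xs \<le> length (concat (map f xs))"
proof (induction xs)
  case (Cons x xs)
  with assms[of x] show ?case by (cases "f x") simp_all
qed simp

lemma exec_tally:
  assumes x: "x = 4 # concat (map encode_nat ns) @ 5 # 4 # concat (map encode_vote vs) @ 5 # r"
    and vs: "\<forall>(w, b) \<in> set vs. b \<noteq> []" and d: "\<not> is_digit d"
    and L: "length x \<le> L" "length (binary_digits c) \<le> L"
  shows "\<exists>as f'. digits as \<and> val as = points vs c \<and> length as \<le> L \<and>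
    exec tally (200 * (L * L) + 300 * L + 20)
      [(d # l0, encode_nat c @ r0), ([0], x), (0 # m, []), A, ([], [f]), G]
      [(d # l0, encode_nat c @ r0),
       (rev (4 # concat (map encode_nat ns) @ 5 # 4 # concat (map encode_vote vs)) @ [0], 5 # r),
       (0 # m, as), A, ([], [f']), G]"
proof -
  let ?ns = "concat (map encode_nat ns)" and ?vs = "concat (map encode_vote vs)"
  let ?S = "\<lambda>t B F. [(d # l0, encode_nat c @ r0), t, B, A, ([], [F]), G]"
  have no5: "\<forall>s \<in> set (4 # ?ns). s \<noteq> 5"
    using encode_symbols(2)[of ns] by (auto simp del: set_concat)
  have 1: "exec (scan 1 MoveRight (\<lambda>s. s \<noteq> 5)) (3 * length (4 # ?ns) + 1)
      (?S ([0], x) (0 # m, []) f)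
      (?S (rev (4 # ?ns) @ [0], 5 # 4 # ?vs @ 5 # r) (0 # m, []) f)"
    using exec_scan_right[OF _ _ no5, of 1 "?S ([0], x) (0 # m, []) f" "[0]" "5 # 4 # ?vs @ 5 # r"]
    by (simp add: x)
  have 2: "exec (two_right 1) 3
      (?S (rev (4 # ?ns) @ [0], 5 # 4 # ?vs @ 5 # r) (0 # m, []) f)
      (?S (4 # 5 # rev (4 # ?ns) @ [0], ?vs @ 5 # r) (0 # m, []) f)"
    by (rule exec_loop_free) (simp_all add: two_right_def mv_def)
  have four: "\<not> is_digit 4" by (simp add: is_digit_def)
  \<comment> \<open>One \<open>L\<close> for the name and one for the votes; the accumulator starts
    empty.\<close>
  have len: "length (binary_digits c) + length ([] :: nat list) + length ?vs \<le> 2 * L"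
    using L x by simp
  obtain as f' where as: "digits as" "val as = points vs c" "length as \<le> length ?vs"
    and 3: "exec tally_votes (length vs * (100 * (2 * L) + 202) + 1)
      (?S (4 # 5 # rev (4 # ?ns) @ [0], ?vs @ 5 # r) (0 # m, []) f)
      (?S (rev ?vs @ 4 # 5 # rev (4 # ?ns) @ [0], 5 # r) (0 # m, as) f')"
    using exec_tally_votes[OF vs _ d four len, where ?l0.0 = l0 and ?r0.0 = r0 and
        l = "5 # rev (4 # ?ns) @ [0]" and r = r and m = m and A = A and f = f and G = G] by auto
  have "length vs \<le> length ?vs"
    by (rule length_concat_map_ge) (metis encode_vote_Cons list.distinct(1))
  then have "length vs \<le> L" using L(1) x by simp
  then have "length vs * (100 * (2 * L) + 202) \<le> L * (100 * (2 * L) + 202)"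
    by (rule mult_le_mono1)
  then have "exec tally (200 * (L * L) + 300 * L + 20) (?S ([0], x) (0 # m, []) f)
      (?S (rev ?vs @ 4 # 5 # rev (4 # ?ns) @ [0], 5 # r) (0 # m, as) f')"
    unfolding tally_def using L(1)
    by (intro exec_mono[OF exec_Seq[OF 1 exec_Seq[OF 2 3]]]) (simp add: x algebra_simps)
  moreover have "length as \<le> L" using as(3) L(1) x by simp
  ultimately show ?thesis
    using as(1,2) by (intro exI[of _ as] exI[of _ f']) simp
qed

section \<open>Checking the candidates and preparing the bound\<close>

lemma exec_rewind:
  assumes "i < length ts" "ts ! i = (rev xs @ [0], r)" "0 \<notin> set xs"
  shows "exec (rewind i) (3 * length xs + 5) ts (ts[i := ([0], xs @ r)])"
proof -
  have "\<forall>x \<in> set (rev xs). x \<noteq> 0" using assms(3) by (metis set_rev)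
  from exec_go_back[OF assms(1,2) this] show ?thesis by simp
qed

lemma exec_check_candidate:
  assumes x: "x = 4 # concat (map encode_nat ns) @ 5 # 4 # concat (map encode_vote vs) @ 5 # r"
    and vs: "\<forall>(w, b) \<in> set vs. b \<noteq> []" and d: "\<not> is_digit d"
    and L: "length x \<le> L" "length (binary_digits c) \<le> L"
    and nz: "0 \<notin> set x" and as: "digits as" "length as \<le> 2 * L"
  shows "\<exists>m' f'. exec check_candidate (200 * (L * L) + 400 * L + 60)
      [(d # l0, encode_nat c @ r0), ([0], x), (0 # m, []), ([0], as), ([], [f]), ([], [g])]
      [(3 # rev (binary_digits c) @ d # l0, r0), ([0], x), (0 # m', []), ([0], as), ([], [f']),
       ([], [if val as < points vs c then 2 else g])]"
proof -
  let ?P = "4 # concat (map encode_nat ns) @ 5 # 4 # concat (map encode_vote vs)"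
  let ?S = "\<lambda>t B A F g. [(d # l0, encode_nat c @ r0), t, B, A, ([], [F]), ([], [g])]"
  let ?g = "if val as < points vs c then 2 else g"
  obtain bs f1 where bs: "digits bs" "val bs = points vs c" "length bs \<le> L"
    and 1: "exec tally (200 * (L * L) + 300 * L + 20)
      (?S ([0], x) (0 # m, []) ([0], as) f g) (?S (rev ?P @ [0], 5 # r) (0 # m, bs) ([0], as) f1 g)"
    using exec_tally[OF x vs d L, where ?l0.0 = l0 and ?r0.0 = r0 and m = m and A = "([0], as)" and
        f = f and G = "([], [g])"] by blast
  have xP: "x = ?P @ 5 # r" using x by simp
  have nzP: "0 \<notin> set ?P" using nz unfolding xP by simp
  have 2: "exec (rewind 1) (3 * length ?P + 5)
      (?S (rev ?P @ [0], 5 # r) (0 # m, bs) ([0], as) f1 g) (?S ([0], x) (0 # m, bs) ([0], as) f1 g)"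
    using exec_rewind[of 1 "?S (rev ?P @ [0], 5 # r) (0 # m, bs) ([0], as) f1 g" ?P, OF _ _ nzP]
    unfolding xP by simp
  \<comment> \<open>The initial flag 1 makes the comparison strict: a tie does not defeat the
    preferred candidate.\<close>
  have 3: "exec (Act 4 (\<lambda>ss. 1) Stay) 1
      (?S ([0], x) (0 # m, bs) ([0], as) f1 g) (?S ([0], x) (0 # m, bs) ([0], as) 1 g)"
    by (rule exec_loop_free) simp_all
  let ?f = "flag (val as < val bs)"
  have 4: "exec compare_loop (20 * (length bs + length as) + 1)
      (?S ([0], x) (0 # m, bs) ([0], as) 1 g)
      (?S ([0], x) (rev bs @ 0 # m, []) (rev as @ [0], []) ?f g)"
    using exec_compare_loop[OF bs(1) as(1), where c = 1] by (simp add: is_digit_def)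
  have 5: "exec (mv 2 MoveRight) 1
      (?S ([0], x) (rev bs @ 0 # m, []) (rev as @ [0], []) ?f g)
      (?S ([0], x) (0 # rev bs @ 0 # m, []) (rev as @ [0], []) ?f g)"
    by (rule exec_loop_free) (simp_all add: mv_def)
  have 6: "exec (rewind 3) (3 * length as + 5)
      (?S ([0], x) (0 # rev bs @ 0 # m, []) (rev as @ [0], []) ?f g)
      (?S ([0], x) (0 # rev bs @ 0 # m, []) ([0], as) ?f g)"
    using exec_rewind[of 3 "?S ([0], x) (0 # rev bs @ 0 # m, []) (rev as @ [0], []) ?f g" as "[]"]
      digits_nonblank[OF as(1)] by auto
  have 7: "exec (If (\<lambda>ss. ss ! 4 = 2) (Act 5 (\<lambda>ss. 2) Stay) Skip) 3
      (?S ([0], x) (0 # rev bs @ 0 # m, []) ([0], as) ?f g)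
      (?S ([0], x) (0 # rev bs @ 0 # m, []) ([0], as) ?f ?g)"
    by (rule exec_loop_free) (simp_all add: bs(2))
  have 8: "exec (scan 0 MoveRight is_digit) (3 * length (binary_digits c) + 1)
      (?S ([0], x) (0 # rev bs @ 0 # m, []) ([0], as) ?f ?g)
      [(rev (binary_digits c) @ d # l0, 3 # r0), ([0], x), (0 # rev bs @ 0 # m, []), ([0], as),
       ([], [?f]), ([], [?g])]"
    using exec_scan_right[of 0 "?S ([0], x) (0 # rev bs @ 0 # m, []) ([0], as) ?f ?g" "d # l0"
        "binary_digits c" "3 # r0" is_digit] digits_nonblank[OF digits_binary_digits[of c]]
    by (simp add: encode_nat_def is_digit_def[of 3])
  have 9: "exec (mv 0 MoveRight) 1
      [(rev (binary_digits c) @ d # l0, 3 # r0), ([0], x), (0 # rev bs @ 0 # m, []), ([0], as),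
       ([], [?f]), ([], [?g])]
      [(3 # rev (binary_digits c) @ d # l0, r0), ([0], x), (0 # rev bs @ 0 # m, []), ([0], as),
       ([], [?f]), ([], [?g])]"
    by (rule exec_loop_free) (simp_all add: mv_def)
  have "length ?P \<le> L" using L(1) unfolding xP by simp
  then have "exec check_candidate (200 * (L * L) + 400 * L + 60)
      (?S ([0], x) (0 # m, []) ([0], as) f g)
      [(3 # rev (binary_digits c) @ d # l0, r0), ([0], x), (0 # rev bs @ 0 # m, []), ([0], as),
       ([], [?f]), ([], [?g])]"
    unfolding check_candidate_def using L(2) as(2) bs(3)
    by (intro exec_mono[OF exec_Seq[OF 1 exec_Seq[OF 2 exec_Seq[OF 3 exec_Seq[OF 4
            exec_Seq[OF 5 exec_Seq[OF 6 exec_Seq[OF 7 exec_Seq[OF 8 9]]]]]]]]]) simp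
  then show ?thesis by blast
qed

text \<open>The initial \<open>g\<close> is arbitrary for the induction, as it carries the verdict
  on earlier candidates; likewise \<open>m\<close>, on which their discarded scores pile up.\<close>

lemma exec_check_candidates:
  assumes x: "x = 4 # concat (map encode_nat ns) @ 5 # 4 # concat (map encode_vote vs) @ 5 # r"
    and vs: "\<forall>(w, b) \<in> set vs. b \<noteq> []" and L: "length x \<le> L"
    and nz: "0 \<notin> set x" and as: "digits as" "length as \<le> 2 * L"
    and cs: "length (concat (map encode_nat cs)) \<le> L" and d: "\<not> is_digit d"
  shows "\<exists>X B F. exec check_candidates (length cs * (200 * (L * L) + 400 * L + 62) + 1)
      [(d # l0, concat (map encode_nat cs) @ 5 # r0), ([0], x), (0 # m, []), ([0], as), ([], [f]), ([], [g])]
      [X, ([0], x), B, ([0], as), F, ([], [if \<exists>c \<in> set cs. val as < points vs c then 2 else g])]"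
  using cs d
proof (induction cs arbitrary: d l0 m f g)
  case Nil
  let ?ts = "[(d # l0, 5 # r0), ([0], x), (0 # m, []), ([0], as), ([], [f]), ([], [g])]"
  have "exec check_candidates 1 ?ts ?ts"
    unfolding check_candidates_def by (rule exec_While_False) simp
  then show ?case
    by (intro exI[of _ "(d # l0, 5 # r0)"] exI[of _ "(0 # m, [])"] exI[of _ "([], [f])"]) simp
next
  case (Cons c cs)
  let ?tail = "concat (map encode_nat cs) @ 5 # r0"
  let ?g = "if val as < points vs c then 2 else g"
  have c: "length (binary_digits c) \<le> L" and tail: "length (concat (map encode_nat cs)) \<le> L"
    using Cons.prems(1) by (simp_all add: length_encode_nat)
  have three: "\<not> is_digit 3" by (simp add: is_digit_def)
  obtain m' f' where 1: "exec check_candidate (200 * (L * L) + 400 * L + 60)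
      [(d # l0, encode_nat c @ ?tail), ([0], x), (0 # m, []), ([0], as), ([], [f]), ([], [g])]
      [(3 # rev (binary_digits c) @ d # l0, ?tail), ([0], x), (0 # m', []), ([0], as), ([], [f']),
       ([], [?g])]"
    using exec_check_candidate[OF x vs Cons.prems(2) L c nz as, where ?l0.0 = l0 and ?r0.0 = ?tail and
        m = m and f = f and g = g] by blast
  let ?h = "if \<exists>c \<in> set cs. val as < points vs c then 2 else ?g"
  obtain X B F where 2: "exec check_candidates (length cs * (200 * (L * L) + 400 * L + 62) + 1)
      [(3 # rev (binary_digits c) @ d # l0, ?tail), ([0], x), (0 # m', []), ([0], as), ([], [f']),
       ([], [?g])]
      [X, ([0], x), B, ([0], as), F, ([], [?h])]"
    using Cons.IH[OF tail three, where ?l0.0 = "rev (binary_digits c) @ d # l0" and m = m' and f = f' and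
        g = ?g] by blast
  have h: "?h = (if \<exists>c \<in> set (c # cs). val as < points vs c then 2 else g)"
    by auto
  have "exec check_candidates
      (200 * (L * L) + 400 * L + 60 + (length cs * (200 * (L * L) + 400 * L + 62) + 1) + 2)
      [(d # l0, encode_nat c @ ?tail), ([0], x), (0 # m, []), ([0], as), ([], [f]), ([], [g])]
      [X, ([0], x), B, ([0], as), F, ([], [?h])]"
    unfolding check_candidates_def
    by (rule exec_While_True[OF _ 1 2[unfolded check_candidates_def]])
      (use encode_nat_Cons[of c] in auto)
  then have "exec check_candidates (length (c # cs) * (200 * (L * L) + 400 * L + 62) + 1)
      [(d # l0, encode_nat c @ ?tail), ([0], x), (0 # m, []), ([0], as), ([], [f]), ([], [g])]
      [X, ([0], x), B, ([0], as), F, ([], [?h])]"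
    by (rule exec_mono) simp
  moreover have "concat (map encode_nat (c # cs)) @ 5 # r0 = encode_nat c @ ?tail"
    by simp
  ultimately show ?case
    unfolding h by metis
qed

lemma exec_prepare:
  assumes x: "x = 4 # concat (map encode_nat ns) @ 5 # 4 # concat (map encode_vote vs) @ 5 #
      4 # concat (map encode_nat ws) @ 5 # encode_nat p"
    and vs: "\<forall>(w, b) \<in> set vs. b \<noteq> []" and nz: "0 \<notin> set x" and L: "length x = L"
  shows "\<exists>as m f. digits as \<and> val as = points vs p + sum_list ws \<and> length as \<le> 2 * L \<and>
    exec prepare (300 * (L * L) + 500 * L + 150)
      [([0], x), ([0], []), ([0], []), ([0], []), ([], [1]), G]
      [([4, 0], tl x), ([0], x), (0 # m, []), ([0], as), ([], [f]), G]"
proof -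
  let ?P = "4 # concat (map encode_nat ns) @ 5 # 4 # concat (map encode_vote vs)"
  let ?ws = "concat (map encode_nat ws)"
  let ?y = "?P @ 5 # 4 # ?ws" and ?p = "binary_digits p"
  let ?S = "\<lambda>X t B A F. [X, t, B, A, ([], [F]), G]"
  \<comment> \<open>Tape 0 with its head on the preferred name; the 5 before it closes the list of
    weights.\<close>
  let ?X = "(5 # rev ?y @ [0], encode_nat p)"
  have xy: "x = ?y @ 5 # ?p @ [3]"
    using x by (simp add: encode_nat_def)
  have lens: "length ?P \<le> L" "length ?y \<le> L" "length ?p \<le> L" "length ?ws \<le> L"
    using L unfolding xy by simp_all
  have nzy: "0 \<notin> set ?y" and nzs: "0 \<notin> set (?y @ [5])"
    using nz unfolding xy by simp_all
  have five: "\<not> is_digit 5" by (simp add: is_digit_def)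
  have 1: "exec (copy 0 1) (5 * length x + 1)
      (?S ([0], x) ([0], []) ([0], []) ([0], []) 1)
      (?S (rev x @ [0], []) (rev x @ [0], []) ([0], []) ([0], []) 1)"
    using exec_copy[of 0 "?S ([0], x) ([0], []) ([0], []) ([0], []) 1" 1 "[0]" x "[0]"] nz by simp
  have 2: "exec (rewind 1) (3 * length x + 5)
      (?S (rev x @ [0], []) (rev x @ [0], []) ([0], []) ([0], []) 1)
      (?S (rev x @ [0], []) ([0], x) ([0], []) ([0], []) 1)"
    using exec_rewind[of 1 "?S (rev x @ [0], []) (rev x @ [0], []) ([0], []) ([0], []) 1" x "[]"] nz
    by simp
  have rev_x: "rev x @ [0] = 3 # rev ?p @ 5 # rev ?y @ [0]"
    unfolding xy by simp
  have 3: "exec (mv 0 MoveLeft) 1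
      (?S (rev x @ [0], []) ([0], x) ([0], []) ([0], []) 1)
      (?S (rev ?p @ 5 # rev ?y @ [0], [3]) ([0], x) ([0], []) ([0], []) 1)"
    unfolding rev_x by (rule exec_loop_free) (simp_all add: mv_def)
  have 4: "exec (go_back 0 is_digit) (3 * length ?p + 5)
      (?S (rev ?p @ 5 # rev ?y @ [0], [3]) ([0], x) ([0], []) ([0], []) 1)
      (?S ?X ([0], x) ([0], []) ([0], []) 1)"
    using exec_go_back[of 0 "?S (rev ?p @ 5 # rev ?y @ [0], [3]) ([0], x) ([0], []) ([0], []) 1"
        "rev ?p" 5 "rev ?y @ [0]" "[3]" is_digit] digits_nonblank[OF digits_binary_digits[of p]] five
    by (simp add: encode_nat_def)
  obtain bs f1 where bs: "digits bs" "val bs = points vs p" "length bs \<le> L"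
    and 5: "exec tally (200 * (L * L) + 300 * L + 20)
      (?S ?X ([0], x) ([0], []) ([0], []) 1)
      (?S ?X (rev ?P @ [0], 5 # 4 # ?ws @ 5 # encode_nat p) ([0], bs) ([0], []) f1)"
    using exec_tally[OF x vs five eq_imp_le[OF L] lens(3), where ?l0.0 = "rev ?y @ [0]" and ?r0.0 = "[]" and
        m = "[]" and A = "([0], [])" and f = 1 and G = G] by auto
  have 6: "exec (two_right 1) 3
      (?S ?X (rev ?P @ [0], 5 # 4 # ?ws @ 5 # encode_nat p) ([0], bs) ([0], []) f1)
      (?S ?X (rev (?P @ [5, 4]) @ [0], ?ws @ 5 # encode_nat p) ([0], bs) ([0], []) f1)"
    by (rule exec_loop_free) (simp_all add: two_right_def mv_def)
  have N: "length bs + length ?ws \<le> 2 * L"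
    using bs(3) lens(4) by simp
  obtain as f2 where as: "digits as" "val as = val bs + sum_list ws" "length as \<le> length bs + length ?ws"
    and 7: "exec add_weights (length ws * (30 * (2 * L) + 20) + 1)
      (?S ?X (rev (?P @ [5, 4]) @ [0], ?ws @ 5 # encode_nat p) ([0], bs) ([0], []) f1)
      (?S ?X (rev ?ws @ rev (?P @ [5, 4]) @ [0], 5 # encode_nat p) ([0], as) ([0], []) f2)"
    using exec_add_weights[OF bs(1) N, where X = ?X and l = "rev (?P @ [5, 4]) @ [0]" and
        r = "encode_nat p" and m = "[]" and A = "([0], [])" and f = f1 and G = G] by blast
  have as_len: "length as \<le> 2 * L" using as(3) N by simp
  have as_nz: "0 \<notin> set as" using digits_nonblank[OF as(1)] by auto
  have rev_y: "rev ?ws @ rev (?P @ [5, 4]) @ [0] = rev ?y @ [0]" by simp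
  have 8: "exec (rewind 1) (3 * length ?y + 5)
      (?S ?X (rev ?ws @ rev (?P @ [5, 4]) @ [0], 5 # encode_nat p) ([0], as) ([0], []) f2)
      (?S ?X ([0], x) ([0], as) ([0], []) f2)"
    using exec_rewind[of 1 "?S ?X (rev ?y @ [0], 5 # encode_nat p) ([0], as) ([0], []) f2" ?y, OF _ _ nzy]
    unfolding rev_y xy by (simp add: encode_nat_def)
  have 9: "exec (copy 2 3) (5 * length as + 1)
      (?S ?X ([0], x) ([0], as) ([0], []) f2)
      (?S ?X ([0], x) (rev as @ [0], []) (rev as @ [0], []) f2)"
    using exec_copy[of 2 "?S ?X ([0], x) ([0], as) ([0], []) f2" 3 "[0]" as "[0]"] as_nz by simp
  have 10: "exec (rewind 3) (3 * length as + 5)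
      (?S ?X ([0], x) (rev as @ [0], []) (rev as @ [0], []) f2)
      (?S ?X ([0], x) (rev as @ [0], []) ([0], as) f2)"
    using exec_rewind[of 3 "?S ?X ([0], x) (rev as @ [0], []) (rev as @ [0], []) f2" as "[]"] as_nz
    by simp
  have 11: "exec (mv 2 MoveRight) 1
      (?S ?X ([0], x) (rev as @ [0], []) ([0], as) f2)
      (?S ?X ([0], x) (0 # rev as @ [0], []) ([0], as) f2)"
    by (rule exec_loop_free) (simp_all add: mv_def)
  have 12: "exec (rewind 0) (3 * length (?y @ [5]) + 5)
      (?S ?X ([0], x) (0 # rev as @ [0], []) ([0], as) f2)
      (?S ([0], x) ([0], x) (0 # rev as @ [0], []) ([0], as) f2)"
    using exec_rewind[of 0 "?S ?X ([0], x) (0 # rev as @ [0], []) ([0], as) f2" "?y @ [5]", OF _ _ nzs]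
    unfolding xy by (simp add: encode_nat_def)
  have 13: "exec (mv 0 MoveRight) 1
      (?S ([0], x) ([0], x) (0 # rev as @ [0], []) ([0], as) f2)
      (?S ([4, 0], tl x) ([0], x) (0 # rev as @ [0], []) ([0], as) f2)"
    by (rule exec_loop_free) (simp_all add: mv_def x)
  \<comment> \<open>The quadratic term gets \<open>60 * (L * L)\<close> from the weights and
    \<open>200 * (L * L)\<close> from the tally.\<close>
  have "length ws \<le> length ?ws"
    by (rule length_concat_map_ge) (simp add: encode_nat_def)
  then have "length ws \<le> L" using lens(4) by simp
  then have "length ws * (30 * (2 * L) + 20) \<le> L * (30 * (2 * L) + 20)"
    by (rule mult_le_mono1)
  also have "\<dots> = 60 * (L * L) + 20 * L"
    by (simp add: algebra_simps)
  finally have "exec prepare (300 * (L * L) + 500 * L + 150)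
      (?S ([0], x) ([0], []) ([0], []) ([0], []) 1)
      (?S ([4, 0], tl x) ([0], x) (0 # rev as @ [0], []) ([0], as) f2)"
    unfolding prepare_def using lens as_len L
    by (intro exec_mono[OF exec_Seq[OF 1 exec_Seq[OF 2 exec_Seq[OF 3 exec_Seq[OF 4
            exec_Seq[OF 5 exec_Seq[OF 6 exec_Seq[OF 7 exec_Seq[OF 8 exec_Seq[OF 9
            exec_Seq[OF 10 exec_Seq[OF 11 exec_Seq[OF 12 13]]]]]]]]]]]]])
      (simp del: length_append length_Cons, simp)
  with as bs(2) as_len show ?thesis by auto
qed

section \<open>The whole procedure on encoded instances\<close>

lemma encode_cwcm_eq:
  "encode_cwcm I = 4 # concat (map encode_nat (candidates I)) @ 5 #
     4 # concat (map encode_vote (fixed_votes I)) @ 5 #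
     4 # concat (map encode_nat (manip_weights I)) @ 5 # encode_nat (preferred I)"
  by (simp add: encode_cwcm_def encode_list_def)

lemma set_encode_cwcm: "set (encode_cwcm I) \<subseteq> {1..<6}"
proof -
  have sub: "{1, 2, 3} \<subseteq> {1..<6 :: nat}" by auto
  note nat = subset_trans[OF encode_symbols(1) sub] and nats = subset_trans[OF encode_symbols(2) sub]
  have "set (encode_vote v) \<subseteq> {1..<6}" for v
    using nat nats by (cases v) (simp add: encode_vote_def encode_list_def del: set_concat)
  then have "set (concat (map encode_vote vs)) \<subseteq> {1..<6}" for vs
    by (simp add: UN_subset_iff)
  then show ?thesis
    using nat nats by (simp add: encode_cwcm_eq del: set_concat)
qed

lemma exec_decide:
  assumes vs: "\<forall>(w, b) \<in> set (fixed_votes I). b \<noteq> []"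
  shows "\<exists>X Y B A F. exec decide (1500 * length (encode_cwcm I) ^ 3 + 1500)
      [([], encode_cwcm I), ([], []), ([], []), ([], []), ([], []), ([], [])]
      [X, Y, B, A, F, ([], [if \<exists>c \<in> set (candidates I).
         points (fixed_votes I) (preferred I) + sum_list (manip_weights I) < points (fixed_votes I) c
         then 2 else 1])]"
proof -
  define x where "x = encode_cwcm I"
  define L where "L = length x"
  let ?ns = "concat (map encode_nat (candidates I))"
  note x = encode_cwcm_eq[of I, folded x_def]
  have nz: "0 \<notin> set x"
    using set_encode_cwcm[of I] by (auto simp: x_def)
  have 1: "exec initialise 15
      [([], x), ([], []), ([], []), ([], []), ([], []), ([], [])]
      [([0], x), ([0], []), ([0], []), ([0], []), ([], [1]), ([], [1])]"
    by (rule exec_loop_free) (simp_all add: initialise_def mv_def)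
  obtain as m f where as: "digits as" "length as \<le> 2 * L"
      "val as = points (fixed_votes I) (preferred I) + sum_list (manip_weights I)"
    and 2: "exec prepare (300 * (L * L) + 500 * L + 150)
      [([0], x), ([0], []), ([0], []), ([0], []), ([], [1]), ([], [1])]
      [([4, 0], tl x), ([0], x), (0 # m, []), ([0], as), ([], [f]), ([], [1])]"
    using exec_prepare[OF x vs nz L_def[symmetric], where G = "([], [1])"] by blast
  have "length ?ns \<le> L" "length (candidates I) \<le> length ?ns"
    using x by (simp add: L_def) (rule length_concat_map_ge, simp add: encode_nat_def)
  then have ns: "length ?ns \<le> L" "length (candidates I) \<le> L" by simp_all
  have four: "\<not> is_digit 4" by (simp add: is_digit_def)
  define R where "R = 4 # concat (map encode_vote (fixed_votes I)) @ 5 #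
     4 # concat (map encode_nat (manip_weights I)) @ 5 # encode_nat (preferred I)"
  have tl: "tl x = ?ns @ 5 # R" by (simp add: x R_def)
  let ?g = "if \<exists>c \<in> set (candidates I). val as < points (fixed_votes I) c then 2 else 1"
  obtain X B F where 3: "exec check_candidates
        (length (candidates I) * (200 * (L * L) + 400 * L + 62) + 1)
      [([4, 0], tl x), ([0], x), (0 # m, []), ([0], as), ([], [f]), ([], [1])]
      [X, ([0], x), B, ([0], as), F, ([], [?g])]"
    using exec_check_candidates[OF x vs eq_imp_le[OF L_def[symmetric]] nz as(1,2) ns(1) four,
        where ?l0.0 = "[0]" and ?r0.0 = R and m = m and f = f and g = 1]
    unfolding tl by blast
  have "length (candidates I) * (200 * (L * L) + 400 * L + 62) \<le> L * (200 * (L * L) + 400 * L + 62)"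
    using ns(2) by (rule mult_le_mono1)
  also have "\<dots> = 200 * L ^ 3 + 400 * (L * L) + 62 * L"
    by (simp add: algebra_simps power3_eq_cube)
  finally have "length (candidates I) * (200 * (L * L) + 400 * L + 62)
      \<le> 200 * L ^ 3 + 400 * (L * L) + 62 * L" .
  \<comment> \<open>The cube absorbs the lower powers; the coefficients 200 + 400 + 62 of the checks
    and 300 + 500 of the preparation sum to 1462, below 1500.\<close>
  moreover have "L * L \<le> L ^ 3" "L \<le> L ^ 3"
    by (cases L; simp add: power3_eq_cube)+
  ultimately have "exec decide (1500 * L ^ 3 + 1500)
      [([], x), ([], []), ([], []), ([], []), ([], []), ([], [])]
      [X, ([0], x), B, ([0], as), F, ([], [?g])]"
    unfolding decide_def
    by (intro exec_mono[OF exec_Seq[OF 1 exec_Seq[OF 2 3]]]) linarith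
  then show ?thesis
    unfolding as(3) x_def L_def by blast
qed


section \<open>Winning under plurality\<close>

lemma position_eq_0_iff: "b \<noteq> [] \<Longrightarrow> position b c = 0 \<longleftrightarrow> hd b = c"
  by (cases b) (auto simp: position_def)

lemma position_less: "c \<in> set b \<Longrightarrow> position b c < length b"
  by (induction b) (auto simp: position_def)

lemma average_score_plurality:
  assumes "is_ballot C b" "finite C"
  shows "average_score (plurality (card C)) b c = (if hd b = c then 1 else 0)"
proof -
  have b: "b \<noteq> []" "length b \<le> card C"
    using assms card_mono[of C "set b"] by (auto simp: is_ballot_def distinct_card)
  have nth: "plurality (card C) ! j = (if j = 0 then 1 else 0)" if "j < card C" for j
    using that by (simp add: plurality_def nth_Cons')
  have len: "length (plurality (card C)) = card C"
    by (auto simp: plurality_def)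
  show ?thesis
  proof (cases "c \<in> set b")
    case True
    then show ?thesis
      using position_less[OF True] b(2) nth position_eq_0_iff[OF b(1), of c]
      by (simp add: average_score_def)
  next
    case False
    \<comment> \<open>The sum starts at \<open>length b\<close>, at least 1, and so misses the only
      nonzero position. For a complete ballot, where \<open>c\<close> lies outside \<open>C\<close>,
      it is empty and 0 / 0 yields 0.\<close>
    moreover have "(\<Sum>j = length b..<card C. plurality (card C) ! j) = 0"
    proof (rule sum.neutral, intro ballI)
      fix j assume "j \<in> {length b..<card C}"
      moreover from this have "j \<noteq> 0" using b(1) by (cases b) auto
      ultimately show "plurality (card C) ! j = 0" by (simp add: nth)
    qed
    ultimately show ?thesis
      using b(1) by (auto simp: average_score_def len)
  qed
qed

lemma total_score_plurality:
  assumes "finite C" "\<forall>(w, b) \<in> set vs. is_ballot C b"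
  shows "total_score (plurality (card C)) vs c = of_nat (points vs c)"
  using assms(2)
  by (induction vs) (auto simp: total_score_def points_def average_score_plurality[OF _ assms(1)])

lemma points_append: "points (us @ vs) c = points us c + points vs c"
  by (simp add: points_def)

lemma points_zip_le: "points (zip ws bs) c \<le> sum_list ws"
proof (induction ws arbitrary: bs)
  case (Cons w ws)
  show ?case
    using Cons[of "tl bs"] by (cases bs) (auto simp: points_def)
qed (simp add: points_def)

lemma points_unanimous:
  "points (zip ws (replicate (length ws) [p])) c = (if c = p then sum_list ws else 0)"
  by (induction ws) (auto simp: points_def)

text \<open>Whatever the manipulators cast, \<open>p\<close> gains at most their total weight and no
  rival loses points, which gives necessity. The one-name ballots \<open>[p]\<close> attain both
  extremes at once, which gives sufficiency.\<close>

lemma cwcm_av_plurality_iff: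
  assumes "I \<in> cwcm_instances"
  shows "cwcm_av plurality I \<longleftrightarrow> (\<forall>c \<in> set (candidates I).
    points (fixed_votes I) c \<le> points (fixed_votes I) (preferred I) + sum_list (manip_weights I))"
proof -
  let ?C = "set (candidates I)" and ?p = "preferred I" and ?V = "fixed_votes I"
    and ?T = "manip_weights I"
  have p: "?p \<in> ?C" and V: "\<forall>(w, b) \<in> set ?V. is_ballot ?C b"
    using assms by (auto simp: cwcm_instances_def)
  have win: "?p \<in> winners_av plurality ?C (?V @ zip ?T bs) \<longleftrightarrow>
      (\<forall>c \<in> ?C. points ?V c + points (zip ?T bs) c \<le> points ?V ?p + points (zip ?T bs) ?p)"
    if "\<forall>b \<in> set bs. is_ballot ?C b" for bs
  proof -
    have "\<forall>(w, b) \<in> set (?V @ zip ?T bs). is_ballot ?C b"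
      using V that by (auto dest: set_zip_rightD)
    then show ?thesis
      using p unfolding winners_av_def
      by (simp add: total_score_plurality points_append del: of_nat_add)
  qed
  show ?thesis
  proof
    assume "cwcm_av plurality I"
    then obtain bs where "\<forall>b \<in> set bs. is_ballot ?C b"
        "?p \<in> winners_av plurality ?C (?V @ zip ?T bs)"
      by (auto simp: cwcm_av_def)
    then have "\<forall>c \<in> ?C. points ?V c + points (zip ?T bs) c \<le> points ?V ?p + points (zip ?T bs) ?p"
      by (simp add: win)
    then show "\<forall>c \<in> ?C. points ?V c \<le> points ?V ?p + sum_list ?T"
      using points_zip_le[of ?T bs ?p] by fastforce
  next
    assume *: "\<forall>c \<in> ?C. points ?V c \<le> points ?V ?p + sum_list ?T"
    let ?bs = "replicate (length ?T) [?p]"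
    have "\<forall>b \<in> set ?bs. is_ballot ?C b"
      using p by (auto simp: is_ballot_def)
    moreover from this have "?p \<in> winners_av plurality ?C (?V @ zip ?T ?bs)"
      using * by (auto simp: win points_unanimous)
    ultimately show "cwcm_av plurality I"
      unfolding cwcm_av_def by (intro exI[of _ ?bs]) simp
  qed
qed

theorem theorem5:
  "solvable_in_polynomial_time cwcm_instances (cwcm_av plurality) encode_cwcm"
proof -
  \<comment> \<open>Tape 5 keeps its initial 1 exactly if no candidate exceeds the bound.\<close>
  define M where "M = compile 6 decide (\<lambda>ss. ss ! 5 = 1)"
  have wf: "wf_tm M"
    unfolding M_def by (rule wf_tm_compile[OF wf_decide]) simp
  have M: "num_symbols M = 6" "accept_state M = 0" "reject_state M = 1"
    by (simp_all add: M_def compile_def)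
  \<comment> \<open>1501 instead of 1500 leaves room for the final step from \<open>Skip\<close> to
    the verdict.\<close>
  have main: "\<exists>t \<le> 1501 * length (encode_cwcm I) ^ 3 + 1501.
      state_after M (encode_cwcm I) t = (if cwcm_av plurality I then accept_state M else reject_state M)"
    if I: "I \<in> cwcm_instances" for I
  proof -
    let ?n = "1500 * length (encode_cwcm I) ^ 3 + 1500"
    have vs: "\<forall>(w, b) \<in> set (fixed_votes I). b \<noteq> []"
      using I by (auto simp: cwcm_instances_def is_ballot_def)
    have iff: "(\<exists>c \<in> set (candidates I). points (fixed_votes I) (preferred I) +
        sum_list (manip_weights I) < points (fixed_votes I) c) \<longleftrightarrow> \<not> cwcm_av plurality I"
      by (simp add: cwcm_av_plurality_iff[OF I] not_le)
    obtain X Y B A F where "exec decide ?n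
        [([], encode_cwcm I), ([], []), ([], []), ([], []), ([], []), ([], [])]
        [X, Y, B, A, F, ([], [if \<not> cwcm_av plurality I then 2 else 1])]"
      using exec_decide[OF vs] unfolding iff by blast
    then have "exec decide ?n (([], encode_cwcm I) # replicate (6 - 1) ([], []))
        [X, Y, B, A, F, ([], [if \<not> cwcm_av plurality I then 2 else 1])]"
      by (simp add: numeral_eq_Suc)
    from compile_state_after[OF _ this, of "\<lambda>ss. ss ! 5 = 1"]
    have "state_after M (encode_cwcm I) (Suc ?n) =
        (if cwcm_av plurality I then accept_state M else reject_state M)"
      unfolding M M_def[symmetric] by simp
    then show ?thesis
      by (intro exI[of _ "Suc ?n"]) simp
  qed
  show ?thesis
    unfolding solvable_in_polynomial_time_def
  proof (rule exI[of _ M], rule exI[of _ 1501], rule exI[of _ 3], intro conjI ballI)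
    show "set (encode_cwcm I) \<subseteq> {1..<num_symbols M}" for I
      unfolding M by (rule set_encode_cwcm)
  qed (fact wf main)+
qed

end
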